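(* Let $G=(V,E)$ be a finite connected simple graph with edges $e_1,\dots,e_m$, $m\ge 1$, and let $X_0=\langle w_{e_1}(0),\dots,w_{e_m}(0)\rangle$ be a vector of strictly positive initial edge weights with $\sum_{i=1}^m w_{e_i}(0)=1$. Consider the initial value problem (normalized Ricci flow) for $X(t)=\langle w_{e_1}(t),\dots,w_{e_m}(t)\rangle$ with $w_{e_i}(t)>0$: $$\frac{dw_e}{dt}(t)=-\kappa_e(t)\,w_e(t)+w_e(t)\sum_{h\in E}\kappa_h(t)\,w_h(t)\quad (e\in E),\qquad X(0)=X_0,$$ where $\kappa_e(t)$ is the Ollivier-Lin-Lu-Yau curvature of the edge $e$ in the weighted graph $(V,E,w(t))$. Assume that each edge is always a shortest path between its endpoints along the flow, i.e. for every $T\in(0,\infty]$, every solution $X:[0,T)\to(0,\infty)^m$ of this problem, every $t\in[0,T)$ and every edge $uv\in E$, one has $w_{uv}(t)=d_t(u,v)$, where $d_t$ is the weighted shortest-path distance determined by $w(t)$. Then there exists a unique solution $X(t)$ of the initial value problem defined for all $t\in[0,\infty)$.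
   Context: Weighted graph: $G=(V,E,w)$ with $w_{xy}>0$ for each edge $xy\in E$. The length of a path is the sum of the weights of its edges, and $d(x,y)$ is the minimal length of a path joining $x$ and $y$. Write $x\sim y$ if $xy\in E$. Fix a function $\gamma:\mathbb{R}_+\to\mathbb{R}_+$ (positive-valued on positive reals) that is one-to-one, is such that the curvature defined below is invariant under scaling of the metric (multiplying all weights by a common positive constant), and is Lipschitz on $[\delta,1]$ for every $\delta>0$. For $\alpha\in[0,1]$ and $x\in V$, let $\mu_x^\alpha$ be the probability distribution on $V$ with $\mu_x^\alpha(x)=\alpha$, $\mu_x^\alpha(y)=(1-\alpha)\dfrac{\gamma(w_{xy})}{\sum_{z\sim x}\gamma(w_{xz})}$ if $y\sim x$, and $\mu_x^\alpha(y)=0$ otherwise. Let $W(\mu_1,\mu_2)=\inf_A\sum_{x,y\in V}A(x,y)d(x,y)$, the infimum being over all couplings $A$ of $\mu_1$ and $\mu_2$. For $x\ne y$ set $\kappa_\alpha(x,y)=1-\dfrac{W(\mu_x^\alpha,\mu_y^\alpha)}{d(x,y)}$. The Ollivier-Lin-Lu-Yau curvature is $\kappa(x,y)=\lim_{\alpha\to1}\dfrac{\kappa_\alpha(x,y)}{1-\alpha}$. For an edge $e=xy$, $\kappa_e=\kappa(x,y)$; $\kappa_e(t)$ denotes this quantity computed with the weights $w(t)$. A solution on an interval $[0,T)$ is a differentiable function (one-sided derivative at $0$) with values in $(0,\infty)^m$ satisfying the system and the initial condition. *)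

theory Defs
  imports "HOL-Analysis.Analysis"
begin

definition simple_graph :: "'a set \<Rightarrow> 'a set set \<Rightarrow> bool" where
  "simple_graph V E \<longleftrightarrow> finite V \<and> (\<forall>e\<in>E. e \<subseteq> V \<and> card e = 2)"

definition is_path :: "'a set \<Rightarrow> 'a set set \<Rightarrow> 'a \<Rightarrow> 'a list \<Rightarrow> 'a \<Rightarrow> bool" where
  "is_path V E x p y \<longleftrightarrow>
     p \<noteq> [] \<and> hd p = x \<and> last p = y \<and> distinct p \<and> set p \<subseteq> V \<and>
     successively (\<lambda>u v. {u, v} \<in> E) p"

definition connected_graph :: "'a set \<Rightarrow> 'a set set \<Rightarrow> bool" where
  "connected_graph V E \<longleftrightarrow> (\<forall>x\<in>V. \<forall>y\<in>V. \<exists>p. is_path V E x p y)"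

definition path_length :: "('a set \<Rightarrow> real) \<Rightarrow> 'a list \<Rightarrow> real" where
  "path_length w p = (\<Sum>i<length p - 1. w {p ! i, p ! Suc i})"

text \<open>Paths have no repeated vertices, so on a finite connected graph the minimum is
  taken over a finite nonempty set.\<close>

definition graph_dist :: "'a set \<Rightarrow> 'a set set \<Rightarrow> ('a set \<Rightarrow> real) \<Rightarrow> 'a \<Rightarrow> 'a \<Rightarrow> real" where
  "graph_dist V E w x y = Min (path_length w ` {p. is_path V E x p y})"

definition lazy_measure ::
  "(real \<Rightarrow> real) \<Rightarrow> 'a set \<Rightarrow> 'a set set \<Rightarrow> ('a set \<Rightarrow> real) \<Rightarrow> real \<Rightarrow> 'a \<Rightarrow> 'a \<Rightarrow> real" where
  "lazy_measure \<gamma> V E w \<alpha> x y =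
     (if y = x then \<alpha>
      else if {x, y} \<in> E then
        (1 - \<alpha>) * \<gamma> (w {x, y}) / (\<Sum>z\<in>{z\<in>V. {x, z} \<in> E}. \<gamma> (w {x, z}))
      else 0)"

definition coupling ::
  "'a set \<Rightarrow> ('a \<Rightarrow> real) \<Rightarrow> ('a \<Rightarrow> real) \<Rightarrow> ('a \<Rightarrow> 'a \<Rightarrow> real) \<Rightarrow> bool" where
  "coupling V \<mu> \<nu> A \<longleftrightarrow>
     (\<forall>x\<in>V. \<forall>y\<in>V. 0 \<le> A x y) \<and>
     (\<forall>x\<in>V. (\<Sum>y\<in>V. A x y) = \<mu> x) \<and>
     (\<forall>y\<in>V. (\<Sum>x\<in>V. A x y) = \<nu> y)"

definition wasserstein ::
  "'a set \<Rightarrow> ('a \<Rightarrow> 'a \<Rightarrow> real) \<Rightarrow> ('a \<Rightarrow> real) \<Rightarrow> ('a \<Rightarrow> real) \<Rightarrow> real" where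
  "wasserstein V d \<mu> \<nu> = (INF A\<in>{A. coupling V \<mu> \<nu> A}. \<Sum>x\<in>V. \<Sum>y\<in>V. A x y * d x y)"

definition lazy_curvature ::
  "(real \<Rightarrow> real) \<Rightarrow> 'a set \<Rightarrow> 'a set set \<Rightarrow> ('a set \<Rightarrow> real) \<Rightarrow> real \<Rightarrow> 'a \<Rightarrow> 'a \<Rightarrow> real" where
  "lazy_curvature \<gamma> V E w \<alpha> x y =
     1 - wasserstein V (graph_dist V E w) (lazy_measure \<gamma> V E w \<alpha> x) (lazy_measure \<gamma> V E w \<alpha> y)
         / graph_dist V E w x y"

definition curvature ::
  "(real \<Rightarrow> real) \<Rightarrow> 'a set \<Rightarrow> 'a set set \<Rightarrow> ('a set \<Rightarrow> real) \<Rightarrow> 'a \<Rightarrow> 'a \<Rightarrow> real" where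
  "curvature \<gamma> V E w x y = Lim (at_left 1) (\<lambda>\<alpha>. lazy_curvature \<gamma> V E w \<alpha> x y / (1 - \<alpha>))"

text \<open>The choice of orientation of the edge is immaterial since the curvature is symmetric;
  see \<open>edge_curvature_doubleton\<close> below.\<close>

definition edge_curvature ::
  "(real \<Rightarrow> real) \<Rightarrow> 'a set \<Rightarrow> 'a set set \<Rightarrow> ('a set \<Rightarrow> real) \<Rightarrow> 'a set \<Rightarrow> real" where
  "edge_curvature \<gamma> V E w e = (SOME k. \<exists>x y. e = {x, y} \<and> k = curvature \<gamma> V E w x y)"

lemma is_path_rev: "is_path V E x p y \<Longrightarrow> is_path V E y (rev p) x"
  by (auto simp: is_path_def hd_rev last_rev insert_commute)

lemma path_length_rev: "path_length w (rev p) = path_length w p"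
proof -
  let ?n = "length p - 1"
  have "path_length w (rev p) = (\<Sum>i<?n. w {rev p ! i, rev p ! Suc i})"
    by (simp add: path_length_def)
  also have "\<dots> = (\<Sum>i<?n. w {p ! (?n - Suc i), p ! Suc (?n - Suc i)})"
  proof (rule sum.cong [OF refl])
    fix i assume "i \<in> {..<?n}"
    then have "rev p ! i = p ! Suc (?n - Suc i)" "rev p ! Suc i = p ! (?n - Suc i)"
      by (auto simp: rev_nth intro!: arg_cong [where f = "(!) p"])
    then show "w {rev p ! i, rev p ! Suc i} = w {p ! (?n - Suc i), p ! Suc (?n - Suc i)}"
      by (simp add: insert_commute)
  qed
  also have "\<dots> = path_length w p"
    unfolding path_length_def by (rule sum.nat_diff_reindex)
  finally show ?thesis .
qed

lemma graph_dist_commute: "graph_dist V E w x y = graph_dist V E w y x"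
proof -
  have "path_length w ` {p. is_path V E a p b} \<subseteq> path_length w ` {p. is_path V E b p a}" for a b
  proof safe
    fix p assume "is_path V E a p b"
    then show "path_length w p \<in> path_length w ` {p. is_path V E b p a}"
      by (intro image_eqI [where x = "rev p"]) (simp_all add: is_path_rev path_length_rev)
  qed
  then show ?thesis
    unfolding graph_dist_def by (intro arg_cong [where f = Min] subset_antisym)
qed

lemma wasserstein_commute:
  assumes "\<And>x y. d x y = d y x"
  shows "wasserstein V d \<mu> \<nu> = wasserstein V d \<nu> \<mu>"
proof -
  let ?c = "\<lambda>A. \<Sum>x\<in>V. \<Sum>y\<in>V. A x y * d x y"
  have "?c ` {A. coupling V m n A} \<subseteq> ?c ` {A. coupling V n m A}" for m n
  proof safe
    fix A assume "coupling V m n A"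
    then have "coupling V n m (\<lambda>x y. A y x)"
      by (auto simp: coupling_def)
    moreover have "?c A = ?c (\<lambda>x y. A y x)"
      by (subst sum.swap) (simp add: assms)
    ultimately show "?c A \<in> ?c ` {A. coupling V n m A}"
      by (intro image_eqI [where x = "\<lambda>x y. A y x"]) auto
  qed
  then show ?thesis
    unfolding wasserstein_def by (intro arg_cong [where f = Inf] subset_antisym)
qed

lemma curvature_commute: "curvature \<gamma> V E w x y = curvature \<gamma> V E w y x"
proof -
  have "lazy_curvature \<gamma> V E w \<alpha> x y = lazy_curvature \<gamma> V E w \<alpha> y x" for \<alpha>
    unfolding lazy_curvature_def
    by (simp only: graph_dist_commute [of V E w x y]
        wasserstein_commute [of "graph_dist V E w" V "lazy_measure \<gamma> V E w \<alpha> x",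
          OF graph_dist_commute])
  then show ?thesis
    by (simp only: curvature_def)
qed

lemma edge_curvature_doubleton: "edge_curvature \<gamma> V E w {x, y} = curvature \<gamma> V E w x y"
  unfolding edge_curvature_def
proof (rule some_equality)
  fix k assume "\<exists>x' y'. {x, y} = {x', y'} \<and> k = curvature \<gamma> V E w x' y'"
  then consider "k = curvature \<gamma> V E w x y" | "k = curvature \<gamma> V E w y x"
    by (auto simp: doubleton_eq_iff)
  then show "k = curvature \<gamma> V E w x y"
    by cases (simp_all only: curvature_commute [of \<gamma> V E w y x])
qed blast

text \<open>A condition on \<open>\<gamma>\<close> alone. Quantifying over vertex sets in \<^typ>\<open>nat\<close> covers all
  finite graphs up to isomorphism.\<close>

definition scale_invariant :: "(real \<Rightarrow> real) \<Rightarrow> bool" where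
  "scale_invariant \<gamma> \<longleftrightarrow>
     (\<forall>(V :: nat set) E w c.
        simple_graph V E \<and> connected_graph V E \<and> (\<forall>e\<in>E. 0 < w e) \<and> 0 < c \<longrightarrow>
        (\<forall>x\<in>V. \<forall>y\<in>V. x \<noteq> y \<longrightarrow>
           curvature \<gamma> V E (\<lambda>e. c * w e) x y = curvature \<gamma> V E w x y))"

text \<open>Only the values of \<open>\<gamma>\<close> on the positive reals enter the curvature; at \<open>0\<close> nothing is
  required.\<close>

definition admissible :: "(real \<Rightarrow> real) \<Rightarrow> bool" where
  "admissible \<gamma> \<longleftrightarrow>
     (\<forall>s>0. 0 < \<gamma> s) \<and> inj_on \<gamma> {0<..} \<and> scale_invariant \<gamma> \<and>
     (\<forall>\<delta>>0. \<exists>L. L-lipschitz_on {\<delta>..1} \<gamma>)"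

definition time_interval :: "ereal \<Rightarrow> real set" where
  "time_interval T = {t. 0 \<le> t \<and> ereal t < T}"

text \<open>Only the values on \<open>E\<close> of the weight functions are meaningful. The derivative within
  the half-open interval is one-sided at \<open>0\<close> and two-sided elsewhere.\<close>

definition ricci_flow_solution ::
  "(real \<Rightarrow> real) \<Rightarrow> 'a set \<Rightarrow> 'a set set \<Rightarrow> ('a set \<Rightarrow> real) \<Rightarrow> ereal \<Rightarrow>
   (real \<Rightarrow> 'a set \<Rightarrow> real) \<Rightarrow> bool" where
  "ricci_flow_solution \<gamma> V E X0 T X \<longleftrightarrow>
     (\<forall>e\<in>E. X 0 e = X0 e) \<and>
     (\<forall>t\<in>time_interval T. \<forall>e\<in>E. 0 < X t e) \<and>
     (\<forall>t\<in>time_interval T. \<forall>e\<in>E.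
        ((\<lambda>s. X s e) has_real_derivative
           - edge_curvature \<gamma> V E (X t) e * X t e
           + X t e * (\<Sum>h\<in>E. edge_curvature \<gamma> V E (X t) h * X t h))
          (at t within time_interval T))"

end

theory Submission
  imports Defs
begin

text \<open>The right-hand side of the flow is Lipschitz on every box of weights \<open>[\<delta>, 1]\<close> with \<open>0 < \<delta>\<close>, so
  the initial value problem is well posed as long as the weights neither vanish nor exceed 1. Both are
  excluded on bounded time intervals. The total weight \<open>S\<close> satisfies \<open>S' = K * (S - 1)\<close>, where \<open>K\<close> is
  the sum of all \<open>\<kappa>\<^sub>h * w\<^sub>h\<close>; since \<open>S\<close> starts at 1 it stays 1, and no weight exceeds 1. For the lower
  bound one uses that \<open>\<kappa>\<^sub>e \<le> 2\<close> whatever the weights are (\<open>curvature_le_2\<close>), and that an edge \<open>h\<close> which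
  is a shortest path has \<open>\<kappa>\<^sub>h * w\<^sub>h \<ge> - card V\<close> when the total weight is 1
  (\<open>weighted_curvature_bounds\<close>). Hence \<open>w\<^sub>e' = w\<^sub>e * (- \<kappa>\<^sub>e + K)\<close> is at least
  \<open>- (2 + card E * card V) * w\<^sub>e\<close>, and each weight decays at most exponentially.

  The analysis of the curvature rests on the joint convexity of the Wasserstein distance. Put
  \<open>\<epsilon> = 1 - \<alpha>\<close> and let \<open>W \<epsilon>\<close> be the distance of the two lazy steps. By convexity
  \<open>(d x y - W \<epsilon>) / \<epsilon>\<close> is monotone in \<open>\<epsilon>\<close>. It lies between the negative diameter and \<open>2 * d x y\<close>; the
  upper bound comes from testing with the distance from \<open>x\<close> truncated at \<open>d x y\<close>. Therefore the limit
  exists, and it inherits estimates that are uniform in \<open>\<epsilon>\<close>. Two such estimates give the Lipschitz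
  dependence on the weights. Changing the distance by \<open>\<Delta>\<close> changes the quotient by at most \<open>4 * \<Delta>\<close>,
  because all but \<open>2 * \<epsilon>\<close> of the mass of a coupling sits at the pair \<open>(x, y)\<close>
  (\<open>contraction_rate_cost_change\<close>); changing the transition probabilities by a relative amount \<open>\<eta>\<close>
  costs a multiple of \<open>\<eta>\<close>, because the new distribution is a mixture of the old one and a remainder
  of mass \<open>\<eta>\<close> (\<open>contraction_rate_step_change\<close>).

  For existence up to time \<open>b\<close> the field is made globally Lipschitz by clipping the weights, so that
  Picard iteration converges (\<open>picard_lindelof_global\<close>). The a priori bounds show that the solution
  never reaches the clipped region (\<open>solution_upto\<close>). Uniqueness is Gronwall's inequality for the squared
  distance of two solutions (\<open>solution_unique\<close>), and it lets solutions on bounded intervals be glued.\<close>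

section \<open>Optimal transport between lazy steps\<close>

definition distribution_on :: "'a set \<Rightarrow> ('a \<Rightarrow> real) \<Rightarrow> bool" where
  "distribution_on V p \<longleftrightarrow> (\<forall>z\<in>V. 0 \<le> p z) \<and> sum p V = 1"

definition transport_cost :: "'a set \<Rightarrow> ('a \<Rightarrow> 'a \<Rightarrow> real) \<Rightarrow> ('a \<Rightarrow> 'a \<Rightarrow> real) \<Rightarrow> real" where
  "transport_cost V d A = (\<Sum>u\<in>V. \<Sum>v\<in>V. A u v * d u v)"

lemma product_coupling:
  assumes "distribution_on V p" "distribution_on V q"
  shows "coupling V p q (\<lambda>u v. p u * q v)"
  using assms
  by (auto simp: coupling_def distribution_on_def simp flip: sum_distrib_left sum_distrib_right)

context
  fixes V :: "'a set" and d :: "'a \<Rightarrow> 'a \<Rightarrow> real"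
  assumes cost_nonneg: "\<And>u v. u \<in> V \<Longrightarrow> v \<in> V \<Longrightarrow> 0 \<le> d u v"
begin

lemma wasserstein_le_transport_cost:
  assumes "coupling V p q A"
  shows "wasserstein V d p q \<le> transport_cost V d A"
  unfolding wasserstein_def transport_cost_def
proof (rule cINF_lower)
  show "bdd_below ((\<lambda>A. \<Sum>x\<in>V. \<Sum>y\<in>V. A x y * d x y) ` {A. coupling V p q A})"
    by (rule bdd_belowI [of _ 0])
      (auto simp: coupling_def cost_nonneg intro!: sum_nonneg)
qed (use assms in auto)

lemma wasserstein_greatest:
  assumes "distribution_on V p" "distribution_on V q"
    and "\<And>A. coupling V p q A \<Longrightarrow> c \<le> transport_cost V d A"
  shows "c \<le> wasserstein V d p q"
  unfolding wasserstein_def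
  by (rule cINF_greatest)
    (use assms product_coupling [OF assms(1,2)] in \<open>auto simp: transport_cost_def\<close>)

text \<open>The mixture of two couplings couples the mixed marginals. All limits and estimates
  for the curvature below come from this convexity.\<close>

lemma wasserstein_convex:
  assumes p: "distribution_on V p" "distribution_on V p'"
    and q: "distribution_on V q" "distribution_on V q'"
    and t: "0 \<le> t" "t \<le> 1"
  shows "wasserstein V d (\<lambda>z. (1 - t) * p z + t * p' z) (\<lambda>z. (1 - t) * q z + t * q' z)
    \<le> (1 - t) * wasserstein V d p q + t * wasserstein V d p' q'" (is "?W \<le> _")
proof -
  have mix: "?W \<le> (1 - t) * transport_cost V d A + t * transport_cost V d A'"
    if A: "coupling V p q A" "coupling V p' q' A'" for A A'
  proof -
    have "coupling V (\<lambda>z. (1 - t) * p z + t * p' z) (\<lambda>z. (1 - t) * q z + t * q' z)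
        (\<lambda>u v. (1 - t) * A u v + t * A' u v)"
      using A t by (auto simp: coupling_def sum.distrib simp flip: sum_distrib_left)
    from wasserstein_le_transport_cost [OF this] show ?thesis
      by (simp add: transport_cost_def sum.distrib sum_distrib_left distrib_right mult.assoc)
  qed
  have 1: "?W \<le> (1 - t) * transport_cost V d A + t * wasserstein V d p' q'"
    if A: "coupling V p q A" for A
  proof (cases "t = 0")
    case True
    with mix [OF A product_coupling [OF p(2) q(2)]] show ?thesis by simp
  next
    case False
    with t have "0 < t" by simp
    have "(?W - (1 - t) * transport_cost V d A) / t \<le> wasserstein V d p' q'"
      by (rule wasserstein_greatest [OF p(2) q(2)])
        (use mix [OF A] \<open>0 < t\<close> in \<open>auto simp: field_simps\<close>)
    with \<open>0 < t\<close> show ?thesis by (simp add: field_simps)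
  qed
  show ?thesis
  proof (cases "t = 1")
    case True
    with 1 [OF product_coupling [OF p(1) q(1)]] show ?thesis by simp
  next
    case False
    with t have "0 < 1 - t" by simp
    have "(?W - t * wasserstein V d p' q') / (1 - t) \<le> wasserstein V d p q"
      by (rule wasserstein_greatest [OF p(1) q(1)])
        (use 1 \<open>0 < 1 - t\<close> in \<open>auto simp: field_simps\<close>)
    with \<open>0 < 1 - t\<close> show ?thesis by (simp add: field_simps)
  qed
qed

end

lemma coupling_sum_fst:
  assumes "coupling V p q A"
  shows "(\<Sum>u\<in>V. \<Sum>v\<in>V. A u v * f u) = (\<Sum>u\<in>V. p u * f u)"
  using assms by (simp add: coupling_def flip: sum_distrib_right)

lemma coupling_sum_snd:
  assumes "coupling V p q A"
  shows "(\<Sum>u\<in>V. \<Sum>v\<in>V. A u v * f v) = (\<Sum>v\<in>V. q v * f v)"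
  by (subst sum.swap) (use assms in \<open>simp add: coupling_def flip: sum_distrib_right\<close>)

lemma coupling_mass:
  assumes "coupling V p q A" "distribution_on V p"
  shows "(\<Sum>u\<in>V. \<Sum>v\<in>V. A u v) = 1"
  using assms by (simp add: coupling_def distribution_on_def)

lemma transport_cost_le_diameter:
  assumes "coupling V p q A" "distribution_on V p"
    and "\<And>u v. u \<in> V \<Longrightarrow> v \<in> V \<Longrightarrow> d u v \<le> D"
  shows "transport_cost V d A \<le> D"
proof -
  have "transport_cost V d A \<le> (\<Sum>u\<in>V. \<Sum>v\<in>V. A u v * D)"
    unfolding transport_cost_def
    by (intro sum_mono mult_left_mono) (use assms in \<open>auto simp: coupling_def\<close>)
  also have "\<dots> = D"
    using coupling_mass [OF assms(1,2)] by (simp flip: sum_distrib_right)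
  finally show ?thesis .
qed

text \<open>The measure \<open>\<mu>\<^sub>x\<^sup>\<alpha>\<close> in the parameter \<open>\<epsilon> = 1 - \<alpha>\<close>, the
  probability of leaving \<open>x\<close>; here \<open>p\<close> is the distribution of the vertex moved to.\<close>

definition lazy_step :: "'a \<Rightarrow> ('a \<Rightarrow> real) \<Rightarrow> real \<Rightarrow> 'a \<Rightarrow> real" where
  "lazy_step x p \<epsilon> z = (1 - \<epsilon>) * of_bool (z = x) + \<epsilon> * p z"

lemma sum_lazy_step:
  assumes "finite V" "x \<in> V"
  shows "(\<Sum>z\<in>V. lazy_step x p \<epsilon> z * f z) = (1 - \<epsilon>) * f x + \<epsilon> * (\<Sum>z\<in>V. p z * f z)"
proof -
  have "lazy_step x p \<epsilon> z * f z = (1 - \<epsilon>) * (if z = x then f x else 0) + \<epsilon> * (p z * f z)" for z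
    by (simp add: lazy_step_def algebra_simps)
  then show ?thesis
    using assms by (simp add: sum.distrib flip: sum_distrib_left)
qed

lemma distribution_lazy_step:
  assumes "finite V" "x \<in> V" "distribution_on V p" "0 \<le> \<epsilon>" "\<epsilon> \<le> 1"
  shows "distribution_on V (lazy_step x p \<epsilon>)"
  unfolding distribution_on_def
proof
  show "\<forall>z\<in>V. 0 \<le> lazy_step x p \<epsilon> z"
    using assms by (auto simp: lazy_step_def distribution_on_def)
  show "sum (lazy_step x p \<epsilon>) V = 1"
    using sum_lazy_step [of V x p \<epsilon> "\<lambda>_. 1"] assms by (simp add: distribution_on_def)
qed

text \<open>With \<open>\<epsilon> = 1 - \<alpha>\<close> this is \<open>d x y\<close> times the quotient
  \<open>\<kappa>\<^sub>\<alpha> / (1 - \<alpha>)\<close> whose limit is the curvature. Keeping the factor \<open>d x y\<close> avoids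
  dividing by a distance that itself depends on the weights.\<close>

definition contraction_rate ::
  "'a set \<Rightarrow> ('a \<Rightarrow> 'a \<Rightarrow> real) \<Rightarrow> 'a \<Rightarrow> 'a \<Rightarrow> ('a \<Rightarrow> real) \<Rightarrow> ('a \<Rightarrow> real) \<Rightarrow> real \<Rightarrow> real" where
  "contraction_rate V d x y p q \<epsilon> =
     (d x y - wasserstein V d (lazy_step x p \<epsilon>) (lazy_step y q \<epsilon>)) / \<epsilon>"

context
  fixes V :: "'a set" and d :: "'a \<Rightarrow> 'a \<Rightarrow> real" and x y :: 'a and p q :: "'a \<Rightarrow> real"
  assumes finite_V: "finite V" and x: "x \<in> V" and y: "y \<in> V"
    and nonneg: "\<And>u v. u \<in> V \<Longrightarrow> v \<in> V \<Longrightarrow> 0 \<le> d u v"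
    and p: "distribution_on V p" and q: "distribution_on V q"
begin

lemma wasserstein_dirac_le: "wasserstein V d (lazy_step x p 0) (lazy_step y q 0) \<le> d x y"
proof -
  let ?A = "\<lambda>u v. lazy_step x p 0 u * lazy_step y q 0 v"
  have "wasserstein V d (lazy_step x p 0) (lazy_step y q 0) \<le> transport_cost V d ?A"
    by (intro wasserstein_le_transport_cost product_coupling distribution_lazy_step
        finite_V x y p q nonneg) auto
  also have "\<dots> = (\<Sum>u\<in>V. lazy_step x p 0 u * (\<Sum>v\<in>V. lazy_step y q 0 v * d u v))"
    by (simp add: transport_cost_def sum_distrib_left mult.assoc)
  also have "\<dots> = d x y"
    by (simp add: sum_lazy_step finite_V x y)
  finally show ?thesis .
qed

text \<open>A convex function that is at most \<open>d x y\<close> at \<open>0\<close> has monotone difference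
  quotients from the point \<open>(0, d x y)\<close>: the lazy step with parameter \<open>\<epsilon>\<close> is a mixture of the
  step with parameter \<open>0\<close> and the step with a larger parameter \<open>\<epsilon>'\<close>.\<close>

lemma contraction_rate_antimono:
  assumes "0 < \<epsilon>" "\<epsilon> \<le> \<epsilon>'" "\<epsilon>' \<le> 1"
  shows "contraction_rate V d x y p q \<epsilon>' \<le> contraction_rate V d x y p q \<epsilon>"
proof -
  define t where "t = \<epsilon> / \<epsilon>'"
  have t: "0 < t" "t \<le> 1" and \<epsilon>: "\<epsilon> = t * \<epsilon>'"
    using assms by (auto simp: t_def)
  let ?W = "\<lambda>\<epsilon>. wasserstein V d (lazy_step x p \<epsilon>) (lazy_step y q \<epsilon>)"
  have *: "lazy_step z r \<epsilon> = (\<lambda>v. (1 - t) * lazy_step z r 0 v + t * lazy_step z r \<epsilon>' v)" for z r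
    by (auto simp: lazy_step_def \<epsilon> algebra_simps)
  have "?W \<epsilon> \<le> (1 - t) * ?W 0 + t * ?W \<epsilon>'"
    unfolding * [of x p] * [of y q]
    by (intro wasserstein_convex distribution_lazy_step finite_V x y p q nonneg)
      (use assms t in auto)
  also have "\<dots> \<le> (1 - t) * d x y + t * ?W \<epsilon>'"
    using wasserstein_dirac_le t by (intro add_right_mono mult_left_mono) auto
  finally have "t * (d x y - ?W \<epsilon>') \<le> d x y - ?W \<epsilon>"
    by (simp add: algebra_simps)
  then have "t * (d x y - ?W \<epsilon>') / (t * \<epsilon>') \<le> (d x y - ?W \<epsilon>) / (t * \<epsilon>')"
    using assms t by (intro divide_right_mono) auto
  then show ?thesis
    using t by (simp add: contraction_rate_def \<epsilon>)
qed

text \<open>By monotonicity the case \<open>\<epsilon> = 1\<close> is the worst one, and there every coupling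
  costs at most the diameter.\<close>

lemma contraction_rate_lower:
  assumes \<epsilon>: "0 < \<epsilon>" "\<epsilon> \<le> 1" and D: "\<And>u v. u \<in> V \<Longrightarrow> v \<in> V \<Longrightarrow> d u v \<le> D"
  shows "- D \<le> contraction_rate V d x y p q \<epsilon>"
proof -
  have "- D \<le> contraction_rate V d x y p q 1"
  proof -
    have "distribution_on V (lazy_step x p 1)" "distribution_on V (lazy_step y q 1)"
      by (auto intro!: distribution_lazy_step finite_V x y p q)
    note c = product_coupling [OF this]
    have "wasserstein V d (lazy_step x p 1) (lazy_step y q 1) \<le> D"
      by (rule order_trans [OF wasserstein_le_transport_cost [OF nonneg c]
            transport_cost_le_diameter [OF c]])
        (auto intro!: distribution_lazy_step finite_V x p D)
    then show ?thesis
      using nonneg [OF x y] by (simp add: contraction_rate_def)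
  qed
  also have "\<dots> \<le> contraction_rate V d x y p q \<epsilon>"
    by (rule contraction_rate_antimono) (use \<epsilon> in auto)
  finally show ?thesis .
qed

text \<open>The easy half of Kantorovich duality: a 1-Lipschitz \<open>f\<close> bounds every transport
  cost below by the difference of its means. The values of \<open>f\<close> lie between \<open>f x = 0\<close> and
  \<open>f y = d x y\<close>, so moving with probability \<open>\<epsilon>\<close> changes each mean by at most \<open>\<epsilon> * d x y\<close>,
  however long the edges at \<open>x\<close> and \<open>y\<close> are.\<close>

lemma contraction_rate_upper:
  assumes \<epsilon>: "0 < \<epsilon>" "\<epsilon> \<le> 1"
    and f: "\<And>u v. u \<in> V \<Longrightarrow> v \<in> V \<Longrightarrow> f v - f u \<le> d u v"
    and f_bounds: "\<And>v. v \<in> V \<Longrightarrow> 0 \<le> f v" "\<And>v. v \<in> V \<Longrightarrow> f v \<le> d x y"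
    and f_xy: "f x = 0" "f y = d x y"
  shows "contraction_rate V d x y p q \<epsilon> \<le> 2 * d x y"
proof -
  have "(1 - 2 * \<epsilon>) * d x y \<le> wasserstein V d (lazy_step x p \<epsilon>) (lazy_step y q \<epsilon>)"
  proof (rule wasserstein_greatest [OF nonneg])
    fix A assume A: "coupling V (lazy_step x p \<epsilon>) (lazy_step y q \<epsilon>) A"
    have "(\<Sum>v\<in>V. p v * f v) \<le> (\<Sum>v\<in>V. p v * d x y)"
      using p by (intro sum_mono mult_left_mono f_bounds) (auto simp: distribution_on_def)
    also have "\<dots> = d x y"
      using p by (simp add: distribution_on_def flip: sum_distrib_right)
    finally have pf: "(\<Sum>v\<in>V. p v * f v) \<le> d x y" .
    have qf: "0 \<le> (\<Sum>v\<in>V. q v * f v)"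
      using q by (intro sum_nonneg mult_nonneg_nonneg f_bounds) (auto simp: distribution_on_def)
    have "(1 - 2 * \<epsilon>) * d x y = (1 - \<epsilon>) * d x y - \<epsilon> * d x y"
      by (simp add: algebra_simps)
    also have "\<dots> \<le> ((1 - \<epsilon>) * f y + \<epsilon> * (\<Sum>v\<in>V. q v * f v))
        - ((1 - \<epsilon>) * f x + \<epsilon> * (\<Sum>v\<in>V. p v * f v))"
      using mult_left_mono [OF pf, of \<epsilon>] mult_nonneg_nonneg [OF _ qf, of \<epsilon>] \<epsilon>
      unfolding f_xy by linarith
    also have "\<dots> = (\<Sum>u\<in>V. \<Sum>v\<in>V. A u v * f v) - (\<Sum>u\<in>V. \<Sum>v\<in>V. A u v * f u)"
      by (simp only: coupling_sum_fst [OF A] coupling_sum_snd [OF A]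
          sum_lazy_step [OF finite_V x] sum_lazy_step [OF finite_V y])
    also have "\<dots> = (\<Sum>u\<in>V. \<Sum>v\<in>V. A u v * (f v - f u))"
      by (simp add: sum_subtractf right_diff_distrib)
    also have "\<dots> \<le> transport_cost V d A"
      unfolding transport_cost_def
      by (intro sum_mono mult_left_mono f) (use A in \<open>auto simp: coupling_def\<close>)
    finally show "(1 - 2 * \<epsilon>) * d x y \<le> transport_cost V d A" .
  qed (use \<epsilon> in \<open>auto intro!: distribution_lazy_step finite_V x y p q\<close>)
  then show ?thesis
    using \<epsilon> by (simp add: contraction_rate_def field_simps)
qed

text \<open>The crude bound \<open>\<Delta>\<close> for the change of the Wasserstein distance would be useless
  after division by \<open>\<epsilon>\<close>. The factor \<open>\<epsilon>\<close> is gained because a coupling of the two lazy steps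
  leaves all mass except \<open>2 * \<epsilon>\<close> at the pair \<open>(x, y)\<close>, and the contribution of that pair cancels
  against the change of \<open>d x y\<close>.\<close>

lemma contraction_rate_cost_change:
  assumes \<epsilon>: "0 < \<epsilon>" "\<epsilon> \<le> 1"
    and nonneg': "\<And>u v. u \<in> V \<Longrightarrow> v \<in> V \<Longrightarrow> 0 \<le> d' u v"
    and \<Delta>: "\<And>u v. u \<in> V \<Longrightarrow> v \<in> V \<Longrightarrow> \<bar>d u v - d' u v\<bar> \<le> \<Delta>"
  shows "contraction_rate V d x y p q \<epsilon> - 4 * \<Delta> \<le> contraction_rate V d' x y p q \<epsilon>"
proof -
  let ?p = "lazy_step x p \<epsilon>" and ?q = "lazy_step y q \<epsilon>"
  have dist: "distribution_on V ?p" "distribution_on V ?q"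
    using \<epsilon> by (auto intro!: distribution_lazy_step finite_V x y p q)
  have \<Delta>0: "0 \<le> \<Delta>"
    using \<Delta> [OF x y] by linarith
  have "wasserstein V d' ?p ?q - d' x y + d x y - 4 * \<epsilon> * \<Delta> \<le> transport_cost V d A'"
    if A: "coupling V ?p ?q A'" for A'
  proof -
    let ?c = "\<lambda>u v. (d' u v - d u v) - (d' x y - d x y)"
    \<comment> \<open>The cost difference relative to the pair (x, y) vanishes there and is at most twice \<open>\<Delta>\<close> elsewhere.\<close>
    have c: "?c u v \<le> 2 * \<Delta> * of_bool (u \<noteq> x) + 2 * \<Delta> * of_bool (v \<noteq> y)"
      if "u \<in> V" "v \<in> V" for u v
      using \<Delta> [OF that] \<Delta> [OF x y] \<Delta>0 by (cases "u = x"; cases "v = y") auto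
    have off: "(\<Sum>v\<in>V. lazy_step z r \<epsilon> v * (2 * \<Delta> * of_bool (v \<noteq> z))) \<le> 2 * \<epsilon> * \<Delta>"
      if "z \<in> V" "distribution_on V r" for z r
    proof -
      have "(\<Sum>v\<in>V. r v * (2 * \<Delta> * of_bool (v \<noteq> z))) \<le> (\<Sum>v\<in>V. r v * (2 * \<Delta>))"
        using \<Delta>0 that by (intro sum_mono mult_left_mono) (auto simp: distribution_on_def)
      also have "\<dots> = 2 * \<Delta>"
        using that by (simp add: distribution_on_def flip: sum_distrib_right)
      finally show ?thesis
        using \<epsilon> that(1) by (simp add: sum_lazy_step finite_V)
    qed
    have "transport_cost V d' A' - transport_cost V d A' - (d' x y - d x y)
        = (\<Sum>u\<in>V. \<Sum>v\<in>V. A' u v * (d' u v - d u v)) - (\<Sum>u\<in>V. \<Sum>v\<in>V. A' u v * (d' x y - d x y))"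
      using coupling_mass [OF A dist(1)]
      by (simp add: transport_cost_def sum_subtractf right_diff_distrib flip: sum_distrib_right)
    also have "\<dots> = (\<Sum>u\<in>V. \<Sum>v\<in>V. A' u v * ?c u v)"
      by (simp add: sum_subtractf right_diff_distrib)
    also have "\<dots> \<le> (\<Sum>u\<in>V. \<Sum>v\<in>V. A' u v *
        (2 * \<Delta> * of_bool (u \<noteq> x) + 2 * \<Delta> * of_bool (v \<noteq> y)))"
      by (intro sum_mono mult_left_mono c) (use A in \<open>auto simp: coupling_def\<close>)
    also have "\<dots> = (\<Sum>u\<in>V. \<Sum>v\<in>V. A' u v * (2 * \<Delta> * of_bool (u \<noteq> x)))
        + (\<Sum>u\<in>V. \<Sum>v\<in>V. A' u v * (2 * \<Delta> * of_bool (v \<noteq> y)))"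
      by (simp only: distrib_left sum.distrib)
    also have "\<dots> = (\<Sum>v\<in>V. ?p v * (2 * \<Delta> * of_bool (v \<noteq> x)))
        + (\<Sum>v\<in>V. ?q v * (2 * \<Delta> * of_bool (v \<noteq> y)))"
      by (simp only: coupling_sum_fst [OF A, of "\<lambda>u. 2 * \<Delta> * of_bool (u \<noteq> x)"]
          coupling_sum_snd [OF A, of "\<lambda>v. 2 * \<Delta> * of_bool (v \<noteq> y)"])
    also have "\<dots> \<le> 2 * \<epsilon> * \<Delta> + 2 * \<epsilon> * \<Delta>"
      by (intro add_mono off x y p q)
    finally show ?thesis
      using wasserstein_le_transport_cost [of V d', OF nonneg' A] by (simp add: mult_ac)
  qed
  then have "wasserstein V d' ?p ?q - d' x y + d x y - 4 * \<epsilon> * \<Delta> \<le> wasserstein V d ?p ?q"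
    by (intro wasserstein_greatest [OF nonneg dist])
  then have "(d x y - wasserstein V d ?p ?q - 4 * \<Delta> * \<epsilon>) / \<epsilon> \<le> (d' x y - wasserstein V d' ?p ?q) / \<epsilon>"
    using \<epsilon> by (intro divide_right_mono) (auto simp: mult_ac)
  then show ?thesis
    using \<epsilon> by (simp add: contraction_rate_def diff_divide_distrib)
qed

text \<open>A bounded monotone function has a one-sided limit, here its supremum.\<close>

lemma contraction_rate_converges:
  assumes "\<And>\<epsilon>. 0 < \<epsilon> \<Longrightarrow> \<epsilon> \<le> 1 \<Longrightarrow> contraction_rate V d x y p q \<epsilon> \<le> R"
  shows "\<exists>k. (contraction_rate V d x y p q \<longlongrightarrow> k) (at_right 0)"
proof
  let ?Q = "contraction_rate V d x y p q"
  define k where "k = (SUP \<epsilon>\<in>{0<..1}. ?Q \<epsilon>)"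
  have bdd: "bdd_above (?Q ` {0<..1})"
    by (rule bdd_aboveI [of _ R]) (use assms in auto)
  have near: "\<forall>\<^sub>F \<epsilon> in at_right 0. 0 < \<epsilon> \<and> \<epsilon> \<le> b" if "0 < b" for b :: real
    using that by (auto simp: eventually_at_right_field intro!: exI [of _ b])
  show "(?Q \<longlongrightarrow> k) (at_right 0)"
  proof (rule order_tendstoI)
    fix a assume "a < k"
    then obtain b where b: "b \<in> {0<..1}" "a < ?Q b"
      using less_cSUP_iff [OF _ bdd] by (auto simp: k_def)
    show "\<forall>\<^sub>F \<epsilon> in at_right 0. a < ?Q \<epsilon>"
      using near [of b] b
      by (auto elim!: eventually_mono intro: less_le_trans contraction_rate_antimono)
  next
    fix a assume "k < a"
    show "\<forall>\<^sub>F \<epsilon> in at_right 0. ?Q \<epsilon> < a"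
      using near [of 1]
      by (rule eventually_mono)
        (auto simp: k_def intro!: le_less_trans [OF cSUP_upper [OF _ bdd]] \<open>k < a\<close> [unfolded k_def])
  qed
qed

end

text \<open>If \<open>p'\<close> dominates \<open>(1 - \<eta>) * p\<close>, then \<open>p'\<close> is the mixture of \<open>p\<close> and a further
  distribution with weights \<open>1 - \<eta>\<close> and \<open>\<eta>\<close>, and convexity compares the two rates. For \<open>\<eta> > 1\<close>
  the claim follows from the a priori bounds alone.\<close>

lemma contraction_rate_step_change:
  assumes V: "finite V" "x \<in> V" "y \<in> V"
    and nonneg: "\<And>u v. u \<in> V \<Longrightarrow> v \<in> V \<Longrightarrow> 0 \<le> d u v"
    and p: "distribution_on V p" and q: "distribution_on V q"
    and \<epsilon>: "0 < \<epsilon>" "\<epsilon> \<le> 1"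
    and p': "distribution_on V p'" and q': "distribution_on V q'"
    and \<eta>: "0 < \<eta>"
    and pp': "\<And>z. z \<in> V \<Longrightarrow> (1 - \<eta>) * p z \<le> p' z"
    and qq': "\<And>z. z \<in> V \<Longrightarrow> (1 - \<eta>) * q z \<le> q' z"
    and D: "\<And>u v. u \<in> V \<Longrightarrow> v \<in> V \<Longrightarrow> d u v \<le> D"
    and upper: "contraction_rate V d x y p q \<epsilon> \<le> R"
  shows "contraction_rate V d x y p q \<epsilon> - \<eta> * (R + D) \<le> contraction_rate V d x y p' q' \<epsilon>"
proof -
  have lower: "- D \<le> contraction_rate V d x y r s \<epsilon>"
    if "distribution_on V r" "distribution_on V s" for r s
    by (rule contraction_rate_lower) (use V nonneg that \<epsilon> D in auto)
  show ?thesis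
  proof (cases "\<eta> \<le> 1")
    case True
    define r where "r z = (p' z - (1 - \<eta>) * p z) / \<eta>" for z
    define s where "s z = (q' z - (1 - \<eta>) * q z) / \<eta>" for z
    have r: "distribution_on V r" and s: "distribution_on V s"
      using p q p' q' pp' qq' \<eta>
      by (auto simp: distribution_on_def r_def s_def sum_subtractf
          simp flip: sum_distrib_left sum_divide_distrib)
    have *: "lazy_step x p' \<epsilon> = (\<lambda>v. (1 - \<eta>) * lazy_step x p \<epsilon> v + \<eta> * lazy_step x r \<epsilon> v)"
      "lazy_step y q' \<epsilon> = (\<lambda>v. (1 - \<eta>) * lazy_step y q \<epsilon> v + \<eta> * lazy_step y s \<epsilon> v)"
      using \<eta> by (auto simp: lazy_step_def r_def s_def field_simps)
    let ?W = "\<lambda>p q. wasserstein V d (lazy_step x p \<epsilon>) (lazy_step y q \<epsilon>)"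
    let ?Q = "\<lambda>p q. contraction_rate V d x y p q \<epsilon>"
    have "?W p' q' \<le> (1 - \<eta>) * ?W p q + \<eta> * ?W r s"
      unfolding *
      by (intro wasserstein_convex distribution_lazy_step V p q r s nonneg)
        (use \<epsilon> \<eta> True in auto)
    then have "((1 - \<eta>) * (d x y - ?W p q) + \<eta> * (d x y - ?W r s)) / \<epsilon> \<le> (d x y - ?W p' q') / \<epsilon>"
      using \<epsilon> by (intro divide_right_mono) (auto simp: algebra_simps)
    then have "(1 - \<eta>) * ?Q p q + \<eta> * ?Q r s \<le> ?Q p' q'"
      by (simp add: contraction_rate_def add_divide_distrib)
    moreover have "\<eta> * (- D) \<le> \<eta> * ?Q r s" "\<eta> * ?Q p q \<le> \<eta> * R"
      using lower [OF r s] upper \<eta> by (simp_all only: mult_left_mono less_imp_le)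
    ultimately show ?thesis
      by (simp add: algebra_simps)
  next
    case False
    have "0 \<le> R + D"
      using lower [OF p q] upper by linarith
    then have "1 * (R + D) \<le> \<eta> * (R + D)"
      using False by (intro mult_right_mono) auto
    then show ?thesis
      using lower [OF p' q'] upper by simp
  qed
qed

section \<open>Shortest-path distance\<close>

lemma eventually_right_0: "\<forall>\<^sub>F \<epsilon> in at_right (0::real). 0 < \<epsilon> \<and> \<epsilon> \<le> 1"
  by (auto simp: eventually_at_right_field intro!: exI [of _ 1])

lemma is_path_edge:
  assumes "is_path V E x p y" "i < length p - 1"
  shows "{p ! i, p ! Suc i} \<in> E"
  using assms by (auto simp: is_path_def successively_conv_nth)

lemma path_length_bounded:
  fixes c :: real
  assumes p: "is_path V E x p y" and "finite V" and "0 \<le> c"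
    and g: "\<And>e. e \<in> E \<Longrightarrow> g e \<le> c"
  shows "path_length g p \<le> card V * c"
proof -
  have "path_length g p \<le> (\<Sum>i<length p - 1. c)"
    unfolding path_length_def by (intro sum_mono g is_path_edge [OF p]) simp
  also have "\<dots> \<le> card V * c"
  proof -
    have "length p \<le> card V"
      using p card_mono [OF \<open>finite V\<close>, of "set p"] by (simp add: is_path_def distinct_card)
    then show ?thesis
      using \<open>0 \<le> c\<close> by (auto intro!: mult_right_mono)
  qed
  finally show ?thesis .
qed

text \<open>Telescoping turns a bound on each edge into a bound by the length of the path.\<close>

lemma potential_difference_le_path_length:
  assumes p: "is_path V E x p y"
    and f: "\<And>u v. {u, v} \<in> E \<Longrightarrow> f v - f u \<le> w {u, v}"
  shows "f y - f x \<le> path_length w p"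
proof -
  have "f y - f x = f (p ! (length p - 1)) - f (p ! 0)"
    using p by (auto simp: is_path_def hd_conv_nth last_conv_nth)
  also have "\<dots> = (\<Sum>i<length p - 1. f (p ! Suc i) - f (p ! i))"
    by (rule sum_lessThan_telescope [symmetric])
  also have "\<dots> \<le> path_length w p"
    unfolding path_length_def by (intro sum_mono f is_path_edge [OF p]) simp
  finally show ?thesis .
qed

text \<open>The \<open>\<ell>\<^sup>1\<close> distance of two weight functions, seen on the edges only.\<close>

definition weight_gap :: "'a set set \<Rightarrow> ('a set \<Rightarrow> real) \<Rightarrow> ('a set \<Rightarrow> real) \<Rightarrow> real" where
  "weight_gap E w w' = (\<Sum>e\<in>E. \<bar>w e - w' e\<bar>)"

lemma weight_gap_nonneg: "0 \<le> weight_gap E w w'"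
  by (simp add: weight_gap_def sum_nonneg)

lemma weight_gap_commute: "weight_gap E w w' = weight_gap E w' w"
  by (simp add: weight_gap_def abs_minus_commute)

locale finite_graph =
  fixes V :: "'a set" and E :: "'a set set"
  assumes simple: "simple_graph V E" and connected: "connected_graph V E"
begin

lemma finite_V: "finite V"
  using simple by (simp add: simple_graph_def)

lemma finite_E: "finite E"
  by (rule finite_subset [of E "Pow V"]) (use simple in \<open>auto simp: simple_graph_def\<close>)

lemma edgeD:
  assumes "{x, y} \<in> E"
  shows "x \<in> V" "y \<in> V" "x \<noteq> y"
  using assms simple by (auto simp: simple_graph_def card_2_iff doubleton_eq_iff)

lemma edge_cases:
  assumes "e \<in> E"
  obtains x y where "e = {x, y}" "x \<in> V" "y \<in> V" "x \<noteq> y"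
proof -
  from assms simple have "card e = 2"
    by (simp add: simple_graph_def)
  then obtain x y where "e = {x, y}"
    by (auto simp: card_2_iff)
  moreover from this assms edgeD [of x y] have "x \<in> V" "y \<in> V" "x \<noteq> y"
    by simp_all
  ultimately show thesis
    by (rule that)
qed

lemma weight_le_gap:
  assumes "e \<in> E"
  shows "\<bar>w e - w' e\<bar> \<le> weight_gap E w w'"
  unfolding weight_gap_def by (rule member_le_sum) (use assms finite_E in auto)

lemma finite_paths: "finite {p. is_path V E x p y}"
  by (rule finite_subset [OF _ finite_subset_distinct [OF finite_V]]) (auto simp: is_path_def)

lemma graph_dist_le:
  assumes "is_path V E x p y"
  shows "graph_dist V E w x y \<le> path_length w p"
  unfolding graph_dist_def by (rule Min_le) (use finite_paths assms in auto)

lemma shortest_path: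
  assumes "x \<in> V" "y \<in> V"
  obtains p where "is_path V E x p y" "graph_dist V E w x y = path_length w p"
proof -
  have "graph_dist V E w x y \<in> path_length w ` {p. is_path V E x p y}"
    unfolding graph_dist_def
    by (rule Min_in) (use finite_paths assms connected in \<open>auto simp: connected_graph_def\<close>)
  then show thesis
    by (auto intro: that)
qed

lemma graph_dist_upper:
  fixes c :: real
  assumes "x \<in> V" "y \<in> V" "0 \<le> c" "\<And>e. e \<in> E \<Longrightarrow> w e \<le> c"
  shows "graph_dist V E w x y \<le> card V * c"
proof -
  obtain p where "is_path V E x p y" "graph_dist V E w x y = path_length w p"
    using shortest_path assms(1,2) by blast
  then show ?thesis
    using path_length_bounded [OF _ finite_V assms(3,4)] by simp
qed

lemma graph_dist_lower:
  assumes "x \<in> V" "y \<in> V" "x \<noteq> y" "0 < \<delta>" and w: "\<And>e. e \<in> E \<Longrightarrow> \<delta> \<le> w e"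
  shows "\<delta> \<le> graph_dist V E w x y"
proof -
  obtain p where p: "is_path V E x p y" "graph_dist V E w x y = path_length w p"
    using shortest_path assms(1,2) by blast
  have "length p \<noteq> 0" "length p \<noteq> 1"
    using p(1) \<open>x \<noteq> y\<close> by (auto simp: is_path_def length_Suc_conv)
  then have len: "1 \<le> length p - 1"
    by linarith
  have "\<delta> \<le> real (length p - 1) * \<delta>"
    using len \<open>0 < \<delta>\<close> by simp
  also have "\<dots> = (\<Sum>i<length p - 1. \<delta>)"
    by simp
  also have "\<dots> \<le> path_length w p"
    unfolding path_length_def by (intro sum_mono w is_path_edge [OF p(1)]) simp
  finally show ?thesis
    using p by simp
qed

lemma graph_dist_change:
  assumes "x \<in> V" "y \<in> V"
  shows "\<bar>graph_dist V E w x y - graph_dist V E w' x y\<bar> \<le> card V * weight_gap E w w'"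
proof -
  have *: "graph_dist V E w x y - graph_dist V E w' x y \<le> card V * weight_gap E w w'" for w w'
  proof -
    obtain p where p: "is_path V E x p y" "graph_dist V E w' x y = path_length w' p"
      using shortest_path assms by blast
    have "graph_dist V E w x y - graph_dist V E w' x y \<le> path_length w p - path_length w' p"
      using graph_dist_le [OF p(1), of w] p(2) by simp
    also have "\<dots> = path_length (\<lambda>e. w e - w' e) p"
      by (simp add: path_length_def sum_subtractf)
    also have "\<dots> \<le> card V * weight_gap E w w'"
      by (rule path_length_bounded [OF p(1) finite_V weight_gap_nonneg])
        (use weight_le_gap [of _ w w'] in \<open>force simp: abs_le_iff\<close>)
    finally show ?thesis .
  qed
  from * [of w w'] * [of w' w] show ?thesis
    by (simp add: weight_gap_commute [of E w'] abs_le_iff)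
qed

context
  fixes w :: "'a set \<Rightarrow> real"
  assumes w_pos: "\<And>e. e \<in> E \<Longrightarrow> 0 < w e"
begin

lemma graph_dist_nonneg:
  assumes "x \<in> V" "y \<in> V"
  shows "0 \<le> graph_dist V E w x y"
proof -
  obtain p where p: "is_path V E x p y" "graph_dist V E w x y = path_length w p"
    using shortest_path assms by blast
  have "0 \<le> path_length w p"
    unfolding path_length_def
    by (intro sum_nonneg less_imp_le [OF w_pos] is_path_edge [OF p(1)]) simp
  with p(2) show ?thesis
    by simp
qed

lemma graph_dist_pos:
  assumes "x \<in> V" "y \<in> V" "x \<noteq> y" "E \<noteq> {}"
  shows "0 < graph_dist V E w x y"
proof -
  have "0 < Min (w ` E)"
    using finite_E w_pos assms by auto
  also have "\<dots> \<le> graph_dist V E w x y"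
    by (rule graph_dist_lower) (use assms finite_E w_pos in auto)
  finally show ?thesis .
qed

lemma graph_dist_self:
  assumes "x \<in> V"
  shows "graph_dist V E w x x = 0"
proof -
  have "is_path V E x [x] x"
    using assms by (simp add: is_path_def)
  from graph_dist_le [OF this, of w] graph_dist_nonneg [OF assms assms] show ?thesis
    by (simp add: path_length_def)
qed

text \<open>The instance of the triangle inequality in which the second leg is an edge. Appending
  the edge to a shortest path gives a path unless \<open>v\<close> was visited before; then the initial segment
  up to \<open>v\<close> is a path, and it is no longer.\<close>

lemma graph_dist_edge_step:
  assumes "x \<in> V" and uv: "{u, v} \<in> E"
  shows "graph_dist V E w x v \<le> graph_dist V E w x u + w {u, v}"
proof -
  obtain p where p: "is_path V E x p u" "graph_dist V E w x u = path_length w p"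
    using shortest_path assms edgeD by blast
  show ?thesis
  proof (cases "v \<in> set p")
    case False
    have path: "is_path V E x (p @ [v]) v"
      using p(1) False uv edgeD [OF uv] by (auto simp: is_path_def successively_append_iff)
    have "path_length w (p @ [v]) = path_length w p + w {u, v}"
    proof -
      obtain q where "p = q @ [u]"
        using p(1) by (metis append_butlast_last_id is_path_def)
      then show ?thesis
        by (auto simp: path_length_def nth_append less_Suc_eq intro!: sum.cong)
    qed
    with graph_dist_le [OF path, of w] p(2) show ?thesis
      by simp
  next
    case True
    then obtain q r where qr: "p = q @ v # r"
      by (auto simp: in_set_conv_decomp)
    have path: "is_path V E x (q @ [v]) v"
      using p(1) by (auto simp: is_path_def qr successively_append_iff hd_append split: if_splits)
    have "path_length w (q @ [v]) = (\<Sum>i<length q. w {p ! i, p ! Suc i})"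
      by (auto simp: path_length_def qr nth_append intro!: sum.cong)
    also have "\<dots> \<le> path_length w p"
      unfolding path_length_def
      by (rule sum_mono2) (auto simp: qr intro!: less_imp_le w_pos is_path_edge [OF p(1), unfolded qr])
    finally show ?thesis
      using graph_dist_le [OF path, of w] p(2) w_pos [OF uv] by simp
  qed
qed

end

section \<open>Existence and bounds of the curvature\<close>

definition neighbour_step :: "(real \<Rightarrow> real) \<Rightarrow> ('a set \<Rightarrow> real) \<Rightarrow> 'a \<Rightarrow> 'a \<Rightarrow> real" where
  "neighbour_step \<gamma> w x z =
     (if {x, z} \<in> E then \<gamma> (w {x, z}) / (\<Sum>z\<in>{z\<in>V. {x, z} \<in> E}. \<gamma> (w {x, z})) else 0)"

lemma lazy_measure_eq_lazy_step:
  "lazy_measure \<gamma> V E w \<alpha> x = lazy_step x (neighbour_step \<gamma> w x) (1 - \<alpha>)"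
  using edgeD(3) [of x x]
  by (auto simp: lazy_measure_def lazy_step_def neighbour_step_def fun_eq_iff)

lemma neighbour_sum_pos:
  fixes \<gamma> :: "real \<Rightarrow> real"
  assumes "{x, y} \<in> E" "\<And>e. e \<in> E \<Longrightarrow> 0 < \<gamma> (w e)"
  shows "0 < (\<Sum>z\<in>{z\<in>V. {x, z} \<in> E}. \<gamma> (w {x, z}))"
proof (rule sum_pos)
  show "{z \<in> V. {x, z} \<in> E} \<noteq> {}"
    using assms(1) edgeD by blast
qed (use assms finite_V in auto)

lemma distribution_neighbour_step:
  assumes "{x, y} \<in> E" "\<And>e. e \<in> E \<Longrightarrow> 0 < \<gamma> (w e)"
  shows "distribution_on V (neighbour_step \<gamma> w x)"
  unfolding distribution_on_def
proof
  note S = neighbour_sum_pos [of x y \<gamma> w, OF assms]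
  show "\<forall>z\<in>V. 0 \<le> neighbour_step \<gamma> w x z"
    using S assms(2) by (auto simp: neighbour_step_def intro!: divide_nonneg_pos less_imp_le)
  have "sum (neighbour_step \<gamma> w x) V = (\<Sum>z\<in>{z\<in>V. {x, z} \<in> E}. neighbour_step \<gamma> w x z)"
    by (rule sum.mono_neutral_right) (auto simp: finite_V neighbour_step_def)
  also have "\<dots> = 1"
    using S by (simp add: neighbour_step_def flip: sum_divide_distrib)
  finally show "sum (neighbour_step \<gamma> w x) V = 1" .
qed

text \<open>The relative change of each numerator and of the normalizing sum is at most \<open>\<eta>\<close>, and
  \<open>(1 - 2 * \<eta>) * (1 + \<eta>) \<le> 1 - \<eta>\<close>. The multiplicative form of the conclusion is what
  the convexity argument for the contraction rate asks for.\<close>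

lemma neighbour_step_change:
  assumes xy: "{x, y} \<in> E" and g: "0 < g" "\<And>e. e \<in> E \<Longrightarrow> g \<le> \<gamma> (w e)"
    "\<And>e. e \<in> E \<Longrightarrow> g \<le> \<gamma> (w' e)"
    and \<eta>: "0 \<le> \<eta>" "\<And>e. e \<in> E \<Longrightarrow> \<bar>\<gamma> (w e) - \<gamma> (w' e)\<bar> \<le> \<eta> * g"
  shows "(1 - 2 * \<eta>) * neighbour_step \<gamma> w x z \<le> neighbour_step \<gamma> w' x z"
proof (cases "{x, z} \<in> E")
  case True
  let ?N = "{z\<in>V. {x, z} \<in> E}"
  define S where "S w = (\<Sum>z\<in>?N. \<gamma> (w {x, z}))" for w
  have pos: "0 < \<gamma> (w e)" "0 < \<gamma> (w' e)" if "e \<in> E" for e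
    using g that by (auto intro: less_le_trans)
  have S: "0 < S w" "0 < S w'"
    using neighbour_sum_pos [OF xy, of \<gamma> w] neighbour_sum_pos [OF xy, of \<gamma> w'] pos
    by (auto simp: S_def)
  have gap: "\<bar>\<gamma> (w e) - \<gamma> (w' e)\<bar> \<le> \<eta> * \<gamma> (w e)" if "e \<in> E" for e
    using \<eta>(2) [OF that] mult_left_mono [OF g(2) [OF that] \<eta>(1)] by linarith
  have "S w' \<le> (\<Sum>z\<in>?N. (1 + \<eta>) * \<gamma> (w {x, z}))"
    unfolding S_def
  proof (rule sum_mono)
    fix z assume "z \<in> ?N"
    then have "\<bar>\<gamma> (w {x, z}) - \<gamma> (w' {x, z})\<bar> \<le> \<eta> * \<gamma> (w {x, z})"
      by (intro gap) simp
    then show "\<gamma> (w' {x, z}) \<le> (1 + \<eta>) * \<gamma> (w {x, z})"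
      by (simp add: distrib_right)
  qed
  then have S': "S w' \<le> (1 + \<eta>) * S w"
    by (simp add: S_def sum_distrib_left)
  let ?a = "\<gamma> (w {x, z})" and ?a' = "\<gamma> (w' {x, z})"
  have a: "(1 - \<eta>) * ?a \<le> ?a'"
    using gap [OF True] by (simp add: left_diff_distrib)
  have "(1 - 2 * \<eta>) * ?a * S w' \<le> ?a' * S w"
  proof (cases "1 - 2 * \<eta> \<le> 0")
    case True
    then have "(1 - 2 * \<eta>) * (?a * S w') \<le> 0"
      using pos [OF \<open>{x, z} \<in> E\<close>] S by (intro mult_nonpos_nonneg) auto
    moreover have "0 \<le> ?a' * S w"
      using pos [OF \<open>{x, z} \<in> E\<close>] S by simp
    ultimately show ?thesis
      by (simp add: mult.assoc)
  next
    case False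
    then have "(1 - 2 * \<eta>) * ?a * S w' \<le> (1 - 2 * \<eta>) * ?a * ((1 + \<eta>) * S w)"
      using pos [OF True] by (intro mult_left_mono S') auto
    also have "\<dots> = ((1 - \<eta>) - 2 * \<eta>\<^sup>2) * (?a * S w)"
      by (simp add: algebra_simps power2_eq_square)
    also have "\<dots> \<le> (1 - \<eta>) * (?a * S w)"
      using pos [OF True] S by (intro mult_right_mono) auto
    also have "\<dots> \<le> ?a' * S w"
      using mult_right_mono [OF a, of "S w"] S by (simp add: mult.assoc)
    finally show ?thesis .
  qed
  then have "(1 - 2 * \<eta>) * ?a / S w \<le> ?a' / S w'"
    using S by (simp add: field_simps)
  then show ?thesis
    using True by (simp add: neighbour_step_def S_def)
qed (simp add: neighbour_step_def)

text \<open>The quantity whose limit at \<open>0\<close> is \<open>graph_dist V E w x y * curvature \<gamma> V E w x y\<close>.\<close>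

abbreviation rate :: "(real \<Rightarrow> real) \<Rightarrow> ('a set \<Rightarrow> real) \<Rightarrow> 'a \<Rightarrow> 'a \<Rightarrow> real \<Rightarrow> real" where
  "rate \<gamma> w x y \<equiv> contraction_rate V (graph_dist V E w) x y
     (neighbour_step \<gamma> w x) (neighbour_step \<gamma> w y)"

context
  fixes \<gamma> :: "real \<Rightarrow> real" and w :: "'a set \<Rightarrow> real" and x y :: 'a
  assumes w_pos: "\<And>e. e \<in> E \<Longrightarrow> 0 < w e" and \<gamma>_pos: "\<And>e. e \<in> E \<Longrightarrow> 0 < \<gamma> (w e)"
    and xy: "{x, y} \<in> E"
begin

lemma distributions:
  "distribution_on V (neighbour_step \<gamma> w x)" "distribution_on V (neighbour_step \<gamma> w y)"
  using distribution_neighbour_step [of x y \<gamma> w] distribution_neighbour_step [of y x \<gamma> w] xy \<gamma>_pos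
  by (auto simp: insert_commute)

text \<open>The potential is the distance from \<open>x\<close> cut off at \<open>graph_dist V E w x y\<close>.\<close>

lemma rate_upper:
  assumes "0 < \<epsilon>" "\<epsilon> \<le> 1"
  shows "rate \<gamma> w x y \<epsilon> \<le> 2 * graph_dist V E w x y"
proof -
  let ?d = "graph_dist V E w"
  note V = edgeD [OF xy]
  define f where "f v = min (?d x v) (?d x y)" for v
  have f: "f v - f u \<le> ?d u v" if uv: "u \<in> V" "v \<in> V" for u v
  proof -
    obtain p where p: "is_path V E u p v" "?d u v = path_length w p"
      using shortest_path uv by blast
    have "f v - f u \<le> path_length w p"
    proof (rule potential_difference_le_path_length [OF p(1)])
      fix a b assume ab: "{a, b} \<in> E"
      show "f b - f a \<le> w {a, b}"
        using graph_dist_edge_step [of w, OF w_pos V(1) ab] w_pos [OF ab] by (simp add: f_def)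
    qed
    with p(2) show ?thesis by simp
  qed
  show ?thesis
    by (rule contraction_rate_upper [where f = f])
      (use assms distributions f V finite_V graph_dist_nonneg [OF w_pos] graph_dist_self [OF w_pos]
        in \<open>auto simp: f_def\<close>)
qed

lemma rate_lower:
  assumes "0 < \<epsilon>" "\<epsilon> \<le> 1" and "\<And>u v. u \<in> V \<Longrightarrow> v \<in> V \<Longrightarrow> graph_dist V E w u v \<le> D"
  shows "- D \<le> rate \<gamma> w x y \<epsilon>"
  by (rule contraction_rate_lower)
    (use assms distributions edgeD [OF xy] finite_V graph_dist_nonneg [OF w_pos] in auto)

text \<open>This is where the limit defining the curvature is shown to exist.\<close>

lemma rate_tendsto_curvature:
  "(rate \<gamma> w x y \<longlongrightarrow> graph_dist V E w x y * curvature \<gamma> V E w x y) (at_right 0)"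
proof -
  let ?d = "graph_dist V E w x y"
  note V = edgeD [OF xy]
  have d: "0 < ?d"
    by (rule graph_dist_pos [OF w_pos]) (use V xy in auto)
  obtain k where k: "(rate \<gamma> w x y \<longlongrightarrow> k) (at_right 0)"
    using contraction_rate_converges [OF finite_V V(1,2) graph_dist_nonneg [OF w_pos] distributions
        rate_upper] by blast
  have "filterlim (\<lambda>\<alpha>::real. 1 - \<alpha>) (at_right 0) (at_left 1)"
    unfolding filterlim_at
  proof
    show "\<forall>\<^sub>F \<alpha> in at_left (1::real). 1 - \<alpha> \<in> {0<..} \<and> 1 - \<alpha> \<noteq> 0"
      by (auto simp: eventually_at_filter)
    show "((\<lambda>\<alpha>::real. 1 - \<alpha>) \<longlongrightarrow> 0) (at_left 1)"
      by (auto intro!: tendsto_eq_intros)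
  qed
  from filterlim_compose [OF k this]
  have "((\<lambda>\<alpha>. rate \<gamma> w x y (1 - \<alpha>) / ?d) \<longlongrightarrow> k / ?d) (at_left 1)"
    by (intro tendsto_divide tendsto_const) (use d in auto)
  also have "(\<lambda>\<alpha>. rate \<gamma> w x y (1 - \<alpha>) / ?d) = (\<lambda>\<alpha>. lazy_curvature \<gamma> V E w \<alpha> x y / (1 - \<alpha>))"
    using d by (auto simp: contraction_rate_def lazy_curvature_def lazy_measure_eq_lazy_step field_simps)
  finally have "curvature \<gamma> V E w x y = k / ?d"
    unfolding curvature_def by (intro tendsto_Lim) auto
  then show ?thesis
    using k d by simp
qed

text \<open>This bound is uniform in the weights: a short edge next to long ones does not have large
  positive curvature. This keeps the term \<open>- \<kappa>\<^sub>e * w\<^sub>e\<close> from driving \<open>w\<^sub>e\<close> to \<open>0\<close> in finite time.\<close>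

lemma curvature_le_2: "curvature \<gamma> V E w x y \<le> 2"
proof -
  have "graph_dist V E w x y * curvature \<gamma> V E w x y \<le> 2 * graph_dist V E w x y"
    by (rule tendsto_upperbound [OF rate_tendsto_curvature])
      (auto intro!: eventually_mono [OF eventually_right_0] rate_upper)
  moreover have "0 < graph_dist V E w x y"
    by (rule graph_dist_pos [OF w_pos]) (use edgeD [OF xy] xy in auto)
  ultimately show ?thesis
    by simp
qed

lemma curvature_lower:
  assumes "\<And>u v. u \<in> V \<Longrightarrow> v \<in> V \<Longrightarrow> graph_dist V E w u v \<le> D"
  shows "- D \<le> graph_dist V E w x y * curvature \<gamma> V E w x y"
  by (rule tendsto_lowerbound [OF rate_tendsto_curvature])
    (auto intro!: eventually_mono [OF eventually_right_0] rate_lower assms)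

end

end

section \<open>Lipschitz dependence of the flow on the weights\<close>

text \<open>Boundedness is included because it makes the class closed under products.\<close>

definition lipschitz_bounded_on ::
  "'a set set \<Rightarrow> ('a set \<Rightarrow> real) set \<Rightarrow> (('a set \<Rightarrow> real) \<Rightarrow> real) \<Rightarrow> bool" where
  "lipschitz_bounded_on E W f \<longleftrightarrow>
     (\<exists>K\<ge>0. (\<forall>w\<in>W. \<bar>f w\<bar> \<le> K) \<and> (\<forall>w\<in>W. \<forall>w'\<in>W. \<bar>f w - f w'\<bar> \<le> K * weight_gap E w w'))"

lemma lipschitz_bounded_onI:
  assumes bound: "\<And>w. w \<in> W \<Longrightarrow> \<bar>f w\<bar> \<le> B"
    and lip: "\<And>w w'. w \<in> W \<Longrightarrow> w' \<in> W \<Longrightarrow> f w - f w' \<le> L * weight_gap E w w'"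
  shows "lipschitz_bounded_on E W f"
  unfolding lipschitz_bounded_on_def
proof (intro exI [of _ "max 0 (max B L)"] conjI ballI)
  fix w w' assume w: "w \<in> W" "w' \<in> W"
  have "L * weight_gap E w w' \<le> max 0 (max B L) * weight_gap E w w'"
    by (intro mult_right_mono weight_gap_nonneg) simp
  with lip [OF w] lip [OF w(2,1)] show "\<bar>f w - f w'\<bar> \<le> max 0 (max B L) * weight_gap E w w'"
    by (simp add: weight_gap_commute [of E w'] abs_le_iff)
qed (use bound in \<open>auto simp: le_max_iff_disj\<close>)

lemma lipschitz_bounded_onE:
  assumes "lipschitz_bounded_on E W f"
  obtains K where "0 \<le> K" "\<And>w. w \<in> W \<Longrightarrow> \<bar>f w\<bar> \<le> K"
    "\<And>w w'. w \<in> W \<Longrightarrow> w' \<in> W \<Longrightarrow> \<bar>f w - f w'\<bar> \<le> K * weight_gap E w w'"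
  using assms unfolding lipschitz_bounded_on_def by blast

lemma lipschitz_bounded_on_add:
  assumes "lipschitz_bounded_on E W f" "lipschitz_bounded_on E W g"
  shows "lipschitz_bounded_on E W (\<lambda>w. f w + g w)"
proof -
  obtain K where K: "0 \<le> K" "\<And>w. w \<in> W \<Longrightarrow> \<bar>f w\<bar> \<le> K"
    "\<And>w w'. w \<in> W \<Longrightarrow> w' \<in> W \<Longrightarrow> \<bar>f w - f w'\<bar> \<le> K * weight_gap E w w'"
    using assms(1) by (rule lipschitz_bounded_onE) (rule that)
  obtain H where H: "0 \<le> H" "\<And>w. w \<in> W \<Longrightarrow> \<bar>g w\<bar> \<le> H"
    "\<And>w w'. w \<in> W \<Longrightarrow> w' \<in> W \<Longrightarrow> \<bar>g w - g w'\<bar> \<le> H * weight_gap E w w'"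
    using assms(2) by (rule lipschitz_bounded_onE) (rule that)
  show ?thesis
  proof (rule lipschitz_bounded_onI [where B = "K + H" and L = "K + H"])
    fix w assume "w \<in> W"
    with K(2) H(2) show "\<bar>f w + g w\<bar> \<le> K + H"
      by (meson abs_triangle_ineq add_mono order_trans)
  next
    fix w w' assume "w \<in> W" "w' \<in> W"
    with K(3) [of w w'] H(3) [of w w'] show "f w + g w - (f w' + g w') \<le> (K + H) * weight_gap E w w'"
      by (simp add: distrib_right)
  qed
qed

lemma lipschitz_bounded_on_mult:
  assumes "lipschitz_bounded_on E W f" "lipschitz_bounded_on E W g"
  shows "lipschitz_bounded_on E W (\<lambda>w. f w * g w)"
proof -
  obtain K where K: "0 \<le> K" "\<And>w. w \<in> W \<Longrightarrow> \<bar>f w\<bar> \<le> K"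
    "\<And>w w'. w \<in> W \<Longrightarrow> w' \<in> W \<Longrightarrow> \<bar>f w - f w'\<bar> \<le> K * weight_gap E w w'"
    using assms(1) by (rule lipschitz_bounded_onE) (rule that)
  obtain H where H: "0 \<le> H" "\<And>w. w \<in> W \<Longrightarrow> \<bar>g w\<bar> \<le> H"
    "\<And>w w'. w \<in> W \<Longrightarrow> w' \<in> W \<Longrightarrow> \<bar>g w - g w'\<bar> \<le> H * weight_gap E w w'"
    using assms(2) by (rule lipschitz_bounded_onE) (rule that)
  show ?thesis
  proof (rule lipschitz_bounded_onI [where B = "K * H" and L = "2 * K * H"])
    fix w assume "w \<in> W"
    with K(1,2) H(2) show "\<bar>f w * g w\<bar> \<le> K * H"
      by (simp add: abs_mult mult_mono')
  next
    fix w w' assume w: "w \<in> W" "w' \<in> W"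
    have "f w * g w - f w' * g w' = f w * (g w - g w') + (f w - f w') * g w'"
      by (simp add: algebra_simps)
    also have "\<dots> \<le> \<bar>f w\<bar> * \<bar>g w - g w'\<bar> + \<bar>f w - f w'\<bar> * \<bar>g w'\<bar>"
      by (intro add_mono) (simp_all flip: abs_mult)
    also have "\<dots> \<le> K * (H * weight_gap E w w') + K * weight_gap E w w' * H"
      by (intro add_mono mult_mono K H w) (use K(1) weight_gap_nonneg [of E w w'] in auto)
    finally show "f w * g w - f w' * g w' \<le> 2 * K * H * weight_gap E w w'"
      by (simp add: algebra_simps)
  qed
qed

lemma lipschitz_bounded_on_const: "lipschitz_bounded_on E W (\<lambda>_. c)"
  by (rule lipschitz_bounded_onI [where B = "\<bar>c\<bar>" and L = 0]) auto

lemma lipschitz_bounded_on_sum: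
  assumes "\<And>i. i \<in> S \<Longrightarrow> lipschitz_bounded_on E W (f i)"
  shows "lipschitz_bounded_on E W (\<lambda>w. \<Sum>i\<in>S. f i w)"
  using assms
  by (induction S rule: infinite_finite_induct)
    (auto intro: lipschitz_bounded_on_const lipschitz_bounded_on_add)

lemma lipschitz_bounded_on_inverse:
  assumes "lipschitz_bounded_on E W f" and \<delta>: "0 < \<delta>" "\<And>w. w \<in> W \<Longrightarrow> \<delta> \<le> f w"
  shows "lipschitz_bounded_on E W (\<lambda>w. inverse (f w))"
proof -
  obtain K where K: "0 \<le> K" "\<And>w. w \<in> W \<Longrightarrow> \<bar>f w\<bar> \<le> K"
    "\<And>w w'. w \<in> W \<Longrightarrow> w' \<in> W \<Longrightarrow> \<bar>f w - f w'\<bar> \<le> K * weight_gap E w w'"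
    using assms(1) by (rule lipschitz_bounded_onE) (rule that)
  have inv: "0 < inverse (f w)" "inverse (f w) \<le> inverse \<delta>" if "w \<in> W" for w
    using \<delta>(1) \<delta>(2) [OF that] by (auto intro: le_imp_inverse_le)
  show ?thesis
  proof (rule lipschitz_bounded_onI [where B = "inverse \<delta>" and L = "K * (inverse \<delta> * inverse \<delta>)"])
    fix w assume "w \<in> W"
    with inv show "\<bar>inverse (f w)\<bar> \<le> inverse \<delta>"
      by (simp add: abs_of_pos less_imp_le)
  next
    fix w w' assume w: "w \<in> W" "w' \<in> W"
    have pos: "0 < f w" "0 < f w'"
      using \<delta>(1) \<delta>(2) w by (auto intro: less_le_trans)
    have "inverse (f w) - inverse (f w') = (f w' - f w) * (inverse (f w) * inverse (f w'))"
      using pos by (simp add: field_simps)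
    also have "\<dots> \<le> \<bar>f w - f w'\<bar> * (inverse (f w) * inverse (f w'))"
      using pos by (intro mult_right_mono) auto
    also have "\<dots> \<le> (K * weight_gap E w w') * (inverse \<delta> * inverse \<delta>)"
    proof (rule mult_mono)
      show "inverse (f w) * inverse (f w') \<le> inverse \<delta> * inverse \<delta>"
        by (rule mult_mono [OF inv(2) [OF w(1)] inv(2) [OF w(2)]]) (use pos \<delta>(1) in auto)
    qed (use pos K(1) K(3) [OF w] weight_gap_nonneg [of E w w'] in auto)
    finally show "inverse (f w) - inverse (f w') \<le> K * (inverse \<delta> * inverse \<delta>) * weight_gap E w w'"
      by (simp add: mult_ac)
  qed
qed

definition weight_box :: "'a set set \<Rightarrow> real \<Rightarrow> real \<Rightarrow> ('a set \<Rightarrow> real) set" where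
  "weight_box E \<delta> M = {w. \<forall>e\<in>E. \<delta> \<le> w e \<and> w e \<le> M}"

context finite_graph
begin

lemma lipschitz_bounded_on_weight:
  assumes "e \<in> E" "0 \<le> \<delta>"
  shows "lipschitz_bounded_on E (weight_box E \<delta> M) (\<lambda>w. w e)"
proof (rule lipschitz_bounded_onI [where B = M and L = 1])
  show "w e - w' e \<le> 1 * weight_gap E w w'" for w w'
    using weight_le_gap [OF assms(1), of w w'] by simp
qed (use assms in \<open>force simp: weight_box_def\<close>)

text \<open>The curvature sees the weights and \<open>\<gamma>\<close> only through the values \<open>w e\<close> and \<open>\<gamma> (w e)\<close> on
  edges, so \<open>\<gamma>\<close> may be altered at numbers that do not occur as weights.\<close>

lemma curvature_cong:
  fixes \<gamma> \<gamma>' :: "real \<Rightarrow> real"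
  assumes w: "\<And>e. e \<in> E \<Longrightarrow> w e = w' e" and \<gamma>: "\<And>e. e \<in> E \<Longrightarrow> \<gamma> (w e) = \<gamma>' (w' e)"
  shows "curvature \<gamma> V E w x y = curvature \<gamma>' V E w' x y"
proof -
  have "path_length w p = path_length w' p" if "is_path V E x p y" for p x y
    unfolding path_length_def by (intro sum.cong refl w is_path_edge [OF that]) simp
  then have "graph_dist V E w = graph_dist V E w'"
    by (auto simp: graph_dist_def fun_eq_iff intro!: arg_cong [where f = Min] image_cong)
  moreover have "lazy_measure \<gamma> V E w = lazy_measure \<gamma>' V E w'"
    by (auto simp: lazy_measure_def fun_eq_iff \<gamma>)
  ultimately show ?thesis
    by (simp add: curvature_def lazy_curvature_def)
qed

lemma edge_curvature_cong:
  assumes "e \<in> E" "\<And>e. e \<in> E \<Longrightarrow> w e = w' e" "\<And>e. e \<in> E \<Longrightarrow> \<gamma> (w e) = \<gamma>' (w' e)"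
  shows "edge_curvature \<gamma> V E w e = edge_curvature \<gamma>' V E w' e"
proof -
  obtain x y where "e = {x, y}"
    using edge_cases [OF assms(1)] by blast
  then show ?thesis
    using curvature_cong [of w w' \<gamma> \<gamma>', OF assms(2,3)] by (simp add: edge_curvature_doubleton)
qed

text \<open>First the step distributions are exchanged at fixed distance, then the distance at fixed
  step distributions. In this order the upper bound on the rate is needed only for a matching pair
  of distance and step distributions, for which it is known.\<close>

lemma scaled_curvature_change:
  fixes \<delta> g L M :: real
  assumes xy: "{x, y} \<in> E" and "0 < \<delta>" and "0 < g" and "0 < L"
    and g: "\<And>s. \<delta> \<le> s \<Longrightarrow> s \<le> M \<Longrightarrow> g \<le> \<gamma> s"
    and lip: "\<And>s t. \<delta> \<le> s \<Longrightarrow> s \<le> M \<Longrightarrow> \<delta> \<le> t \<Longrightarrow> t \<le> M \<Longrightarrow> \<bar>\<gamma> s - \<gamma> t\<bar> \<le> L * \<bar>s - t\<bar>"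
    and w: "w \<in> weight_box E \<delta> M" and w': "w' \<in> weight_box E \<delta> M"
  shows "graph_dist V E w x y * curvature \<gamma> V E w x y - graph_dist V E w' x y * curvature \<gamma> V E w' x y
    \<le> (4 * card V + 6 * L / g * (card V * M)) * weight_gap E w w'"
proof (cases "weight_gap E w w' = 0")
  case True
  then have w_eq: "w e = w' e" if "e \<in> E" for e
    using weight_le_gap [OF that, of w w'] by simp
  have "curvature \<gamma> V E w x y = curvature \<gamma> V E w' x y"
    by (rule curvature_cong) (auto simp: w_eq)
  moreover have "graph_dist V E w x y = graph_dist V E w' x y"
    using graph_dist_change [of x y w w'] True edgeD [OF xy] by simp
  ultimately show ?thesis
    using True by simp
next
  case False
  then have gap: "0 < weight_gap E w w'"
    using weight_gap_nonneg [of E w w'] by linarith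
  \<comment> \<open>Bounds the change of \<open>\<gamma>\<close> on every edge, relative to its lower bound \<open>g\<close>.\<close>
  define \<eta> where "\<eta> = L * weight_gap E w w' / g"
  have \<eta>: "0 < \<eta>"
    using gap \<open>0 < L\<close> \<open>0 < g\<close> by (simp add: \<eta>_def)
  define D where "D = card V * M"
  have pos: "0 < w e" "0 < w' e" "g \<le> \<gamma> (w e)" "g \<le> \<gamma> (w' e)"
    "\<bar>\<gamma> (w e) - \<gamma> (w' e)\<bar> \<le> \<eta> * g" if "e \<in> E" for e
  proof -
    have b: "\<delta> \<le> w e" "w e \<le> M" "\<delta> \<le> w' e" "w' e \<le> M"
      using w w' that by (auto simp: weight_box_def)
    with \<open>0 < \<delta>\<close> g show "0 < w e" "0 < w' e" "g \<le> \<gamma> (w e)" "g \<le> \<gamma> (w' e)"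
      by auto
    have "\<bar>\<gamma> (w e) - \<gamma> (w' e)\<bar> \<le> L * \<bar>w e - w' e\<bar>"
      using b by (rule lip)
    also have "\<dots> \<le> L * weight_gap E w w'"
      using \<open>0 < L\<close> weight_le_gap [OF that] by (intro mult_left_mono) auto
    finally show "\<bar>\<gamma> (w e) - \<gamma> (w' e)\<bar> \<le> \<eta> * g"
      using \<open>0 < g\<close> by (simp add: \<eta>_def)
  qed
  have \<gamma>_pos: "0 < \<gamma> (w e)" "0 < \<gamma> (w' e)" if "e \<in> E" for e
    using pos [OF that] \<open>0 < g\<close> by auto
  have M: "0 \<le> M"
    using xy w \<open>0 < \<delta>\<close> by (force simp: weight_box_def)
  have D: "graph_dist V E w u v \<le> D" if "u \<in> V" "v \<in> V" for u v
    unfolding D_def by (rule graph_dist_upper) (use that w M in \<open>auto simp: weight_box_def\<close>)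
  note V = edgeD [OF xy]
  note dist = distributions [of w \<gamma> x y, OF pos(1) \<gamma>_pos(1) xy]
  note dist' = distributions [of w' \<gamma> x y, OF pos(2) \<gamma>_pos(2) xy]
  let ?c = "4 * (card V * weight_gap E w w') + 2 * \<eta> * (2 * D + D)"
  have rate: "rate \<gamma> w x y \<epsilon> - ?c \<le> rate \<gamma> w' x y \<epsilon>" if \<epsilon>: "0 < \<epsilon>" "\<epsilon> \<le> 1" for \<epsilon>
  proof -
    let ?Q = "\<lambda>d. contraction_rate V d x y (neighbour_step \<gamma> w' x) (neighbour_step \<gamma> w' y) \<epsilon>"
    have "rate \<gamma> w x y \<epsilon> - (2 * \<eta>) * (2 * D + D) \<le> ?Q (graph_dist V E w)"
    proof (rule contraction_rate_step_change [OF finite_V V(1,2) graph_dist_nonneg [OF pos(1)] dist \<epsilon> dist'])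
      show "rate \<gamma> w x y \<epsilon> \<le> 2 * D"
        using rate_upper [of w \<gamma> x y \<epsilon>, OF pos(1) \<gamma>_pos(1) xy \<epsilon>] D [OF V(1,2)] by simp
      show "(1 - 2 * \<eta>) * neighbour_step \<gamma> w x z \<le> neighbour_step \<gamma> w' x z" for z
        by (rule neighbour_step_change [of x y g \<gamma> w w' \<eta> z, OF xy \<open>0 < g\<close> pos(3,4) less_imp_le [OF \<eta>] pos(5)])
      show "(1 - 2 * \<eta>) * neighbour_step \<gamma> w y z \<le> neighbour_step \<gamma> w' y z" for z
        by (rule neighbour_step_change [of y x g \<gamma> w w' \<eta> z, OF _ \<open>0 < g\<close> pos(3,4) less_imp_le [OF \<eta>] pos(5)])
          (use xy in \<open>simp_all add: insert_commute\<close>)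
    qed (use \<eta> D in auto)
    moreover have "?Q (graph_dist V E w) - 4 * (card V * weight_gap E w w') \<le> ?Q (graph_dist V E w')"
      by (rule contraction_rate_cost_change [OF finite_V V(1,2) graph_dist_nonneg [OF pos(1)] dist' \<epsilon>
            graph_dist_nonneg [OF pos(2)] graph_dist_change])
    ultimately show ?thesis
      by simp
  qed
  have ev: "\<forall>\<^sub>F \<epsilon> in at_right 0. rate \<gamma> w x y \<epsilon> - ?c \<le> rate \<gamma> w' x y \<epsilon>"
    by (rule eventually_mono [OF eventually_right_0]) (use rate in blast)
  have "graph_dist V E w x y * curvature \<gamma> V E w x y - ?c
      \<le> graph_dist V E w' x y * curvature \<gamma> V E w' x y"
    by (rule tendsto_le [OF _ rate_tendsto_curvature [of w' \<gamma> x y, OF pos(2) \<gamma>_pos(2) xy]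
          tendsto_diff [OF rate_tendsto_curvature [of w \<gamma> x y, OF pos(1) \<gamma>_pos(1) xy] tendsto_const]])
      (use ev in simp_all)
  then show ?thesis
    by (simp add: \<eta>_def D_def algebra_simps)
qed

definition ricci_field :: "(real \<Rightarrow> real) \<Rightarrow> ('a set \<Rightarrow> real) \<Rightarrow> 'a set \<Rightarrow> real" where
  "ricci_field \<gamma> w e = - edge_curvature \<gamma> V E w e * w e
     + w e * (\<Sum>h\<in>E. edge_curvature \<gamma> V E w h * w h)"

lemma ricci_field_cong:
  assumes "e \<in> E" "\<And>e. e \<in> E \<Longrightarrow> w e = w' e" "\<And>e. e \<in> E \<Longrightarrow> \<gamma> (w e) = \<gamma>' (w' e)"
  shows "ricci_field \<gamma> w e = ricci_field \<gamma>' w' e"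
  using assms edge_curvature_cong [of _ w w' \<gamma> \<gamma>'] by (simp add: ricci_field_def)

context
  fixes \<gamma> :: "real \<Rightarrow> real" and \<delta> M L :: real
  assumes \<delta>: "0 < \<delta>" "\<delta> \<le> M" and \<gamma>_pos: "\<And>s. \<delta> \<le> s \<Longrightarrow> s \<le> M \<Longrightarrow> 0 < \<gamma> s"
    and \<gamma>_lipschitz: "L-lipschitz_on {\<delta>..M} \<gamma>"
begin

text \<open>The limit of the contraction rates is Lipschitz, and so is the distance, which stays above
  \<open>\<delta>\<close>; the curvature is their quotient.\<close>

lemma edge_curvature_lipschitz:
  assumes "e \<in> E"
  shows "lipschitz_bounded_on E (weight_box E \<delta> M) (\<lambda>w. edge_curvature \<gamma> V E w e)"
proof -
  let ?W = "weight_box E \<delta> M"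
  obtain x y where e: "e = {x, y}" and V: "x \<in> V" "y \<in> V" "x \<noteq> y"
    using edge_cases [OF assms] by blast
  with assms have xy: "{x, y} \<in> E" by simp
  let ?d = "\<lambda>w. graph_dist V E w x y" and ?\<kappa> = "\<lambda>w. curvature \<gamma> V E w x y"
  have "continuous_on {\<delta>..M} \<gamma>"
    using \<gamma>_lipschitz by (rule lipschitz_on_continuous_on)
  then obtain s0 where s0: "s0 \<in> {\<delta>..M}" "\<And>s. s \<in> {\<delta>..M} \<Longrightarrow> \<gamma> s0 \<le> \<gamma> s"
    using continuous_attains_inf [of "{\<delta>..M}" \<gamma>] \<delta> by auto
  have w_pos: "0 < w e" and \<gamma>w_pos: "0 < \<gamma> (w e)" if "w \<in> ?W" "e \<in> E" for w e
    using that \<delta> \<gamma>_pos by (auto simp: weight_box_def intro: less_le_trans)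
  have D: "graph_dist V E w u v \<le> card V * M" if "w \<in> ?W" "u \<in> V" "v \<in> V" for w u v
    by (rule graph_dist_upper) (use that \<delta> in \<open>auto simp: weight_box_def\<close>)
  have d_pos: "\<delta> \<le> ?d w" if "w \<in> ?W" for w
    by (rule graph_dist_lower [OF V \<delta>(1)]) (use that in \<open>auto simp: weight_box_def\<close>)
  have d: "lipschitz_bounded_on E ?W ?d"
  proof (rule lipschitz_bounded_onI)
    show "\<bar>?d w\<bar> \<le> card V * M" if "w \<in> ?W" for w
      using D [OF that V(1,2)] d_pos [OF that] \<delta>(1) by simp
    show "?d w - ?d w' \<le> card V * weight_gap E w w'" for w w'
      using graph_dist_change [OF V(1,2), of w w'] by simp
  qed
  have d\<kappa>: "lipschitz_bounded_on E ?W (\<lambda>w. ?d w * ?\<kappa> w)"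
  proof (rule lipschitz_bounded_onI)
    fix w assume w: "w \<in> ?W"
    have "?d w * ?\<kappa> w \<le> ?d w * 2"
      using d_pos [OF w] \<delta>(1) curvature_le_2 [of w \<gamma> x y, OF w_pos [OF w] \<gamma>w_pos [OF w] xy]
      by (intro mult_left_mono) auto
    moreover have "- (card V * M) \<le> ?d w * ?\<kappa> w"
      by (rule curvature_lower [of w \<gamma> x y "card V * M", OF w_pos [OF w] \<gamma>w_pos [OF w] xy D [OF w]])
    ultimately show "\<bar>?d w * ?\<kappa> w\<bar> \<le> 2 * (card V * M)"
      using D [OF w V(1,2)] d_pos [OF w] \<delta>(1) unfolding abs_le_iff by linarith
  next
    fix w w' assume "w \<in> ?W" "w' \<in> ?W"
    then show "?d w * ?\<kappa> w - ?d w' * ?\<kappa> w'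
        \<le> (4 * card V + 6 * (L + 1) / \<gamma> s0 * (card V * M)) * weight_gap E w w'"
    proof (rule scaled_curvature_change [OF xy \<delta>(1), rotated -2])
      show "0 < \<gamma> s0"
        using s0(1) \<gamma>_pos by auto
      \<comment> \<open>The constant is enlarged to be positive, since \<open>L\<close> may be 0.\<close>
      show "0 < L + 1"
        using lipschitz_on_nonneg [OF \<gamma>_lipschitz] by simp
      show "\<gamma> s0 \<le> \<gamma> s" if "\<delta> \<le> s" "s \<le> M" for s
        using s0(2) that by simp
      fix s t assume st: "\<delta> \<le> s" "s \<le> M" "\<delta> \<le> t" "t \<le> M"
      have "\<bar>\<gamma> s - \<gamma> t\<bar> \<le> L * \<bar>s - t\<bar>"
        using lipschitz_onD [OF \<gamma>_lipschitz, of s t] st by (simp add: dist_real_def)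
      then show "\<bar>\<gamma> s - \<gamma> t\<bar> \<le> (L + 1) * \<bar>s - t\<bar>"
        by (simp add: distrib_right)
    qed
  qed
  have "lipschitz_bounded_on E ?W (\<lambda>w. inverse (?d w) * (?d w * ?\<kappa> w))"
    by (intro lipschitz_bounded_on_mult lipschitz_bounded_on_inverse [OF d \<delta>(1)] d_pos d\<kappa>)
  then obtain K where K: "0 \<le> K" "\<And>w. w \<in> ?W \<Longrightarrow> \<bar>inverse (?d w) * (?d w * ?\<kappa> w)\<bar> \<le> K"
    "\<And>w w'. w \<in> ?W \<Longrightarrow> w' \<in> ?W \<Longrightarrow> \<bar>inverse (?d w) * (?d w * ?\<kappa> w)
      - inverse (?d w') * (?d w' * ?\<kappa> w')\<bar> \<le> K * weight_gap E w w'"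
    by (rule lipschitz_bounded_onE) (rule that)
  have \<kappa>: "inverse (?d w) * (?d w * ?\<kappa> w) = ?\<kappa> w" if "w \<in> ?W" for w
    using d_pos [OF that] \<delta>(1) by simp
  show ?thesis
    unfolding e edge_curvature_doubleton
    by (rule lipschitz_bounded_onI [where B = K and L = K])
      (use K \<kappa> in \<open>auto simp: abs_le_iff\<close>)
qed

lemma ricci_field_lipschitz:
  assumes "e \<in> E"
  shows "lipschitz_bounded_on E (weight_box E \<delta> M) (\<lambda>w. ricci_field \<gamma> w e)"
proof -
  have *: "ricci_field \<gamma> w e = (- 1) * (edge_curvature \<gamma> V E w e * w e)
     + w e * (\<Sum>h\<in>E. edge_curvature \<gamma> V E w h * w h)" for w
    by (simp add: ricci_field_def)
  show ?thesis
    unfolding *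
    by (intro lipschitz_bounded_on_add lipschitz_bounded_on_mult lipschitz_bounded_on_sum
        lipschitz_bounded_on_const edge_curvature_lipschitz lipschitz_bounded_on_weight assms)
      (use \<delta> in auto)
qed

end

end

section \<open>Differential equations with a Lipschitz field\<close>

text \<open>The derivative of \<open>u t * exp (- C * t)\<close> is nonpositive.\<close>

lemma gronwall:
  fixes u u' :: "real \<Rightarrow> real"
  assumes "0 \<le> b"
    and deriv: "\<And>t. t \<in> {0..b} \<Longrightarrow> (u has_real_derivative u' t) (at t within {0..b})"
    and bound: "\<And>t. t \<in> {0..b} \<Longrightarrow> u' t \<le> C * u t"
  shows "u b \<le> u 0 * exp (C * b)"
proof -
  define v where "v t = u t * exp (- C * t)" for t
  have v: "(v has_real_derivative (u' t - C * u t) * exp (- C * t)) (at t within {0..b})"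
    if "t \<in> {0..b}" for t
  proof -
    have "((\<lambda>t. exp (- C * t)) has_real_derivative exp (- C * t) * - C) (at t within {0..b})"
      by (auto intro!: derivative_eq_intros)
    from DERIV_mult [OF deriv [OF that] this] show ?thesis
      unfolding v_def by (simp add: algebra_simps)
  qed
  have "v b \<le> v 0"
  proof (rule DERIV_nonpos_imp_decreasing_open [OF \<open>0 \<le> b\<close>])
    show "continuous_on {0..b} v"
      by (rule DERIV_continuous_on) (rule v)
    fix t assume t: "0 < t" "t < b"
    then have "(v has_real_derivative (u' t - C * u t) * exp (- C * t)) (at t)"
      using v [of t] by (simp add: at_within_Icc_at)
    moreover have "(u' t - C * u t) * exp (- C * t) \<le> 0"
      using bound [of t] t by (simp add: mult_nonpos_nonneg)
    ultimately show "\<exists>y. (v has_real_derivative y) (at t) \<and> y \<le> 0"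
      by blast
  qed
  then have "u b / exp (C * b) \<le> u 0"
    by (simp add: v_def exp_minus divide_inverse)
  then show ?thesis
    by (simp add: pos_divide_le_eq)
qed

context
  fixes I :: "'i set" and \<Phi> :: "('i \<Rightarrow> real) \<Rightarrow> 'i \<Rightarrow> real" and L :: real
  assumes finite_I: "finite I"
    and lipschitz: "\<And>u v i. i \<in> I \<Longrightarrow> \<bar>\<Phi> u i - \<Phi> v i\<bar> \<le> L * (\<Sum>j\<in>I. \<bar>u j - v j\<bar>)"
    and L_pos: "0 < L"
begin

lemma lipschitz_field_continuous:
  assumes "i \<in> I" and "\<And>j. j \<in> I \<Longrightarrow> continuous_on S (\<lambda>t. x t j)"
  shows "continuous_on S (\<lambda>t. \<Phi> (x t) i)"
  unfolding continuous_on_def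
proof
  fix t assume t: "t \<in> S"
  have lim: "((\<lambda>s. L * (\<Sum>j\<in>I. \<bar>x s j - x t j\<bar>)) \<longlongrightarrow> L * (\<Sum>j\<in>I. \<bar>x t j - x t j\<bar>)) (at t within S)"
    using assms(2) t by (intro tendsto_intros) (auto simp: continuous_on_def)
  show "((\<lambda>s. \<Phi> (x s) i) \<longlongrightarrow> \<Phi> (x t) i) (at t within S)"
    by (rule LIM_zero_cancel, rule Lim_null_comparison [OF _ lim [simplified]])
      (auto intro!: always_eventually lipschitz assms(1))
qed

primrec picard_iterate :: "('i \<Rightarrow> real) \<Rightarrow> nat \<Rightarrow> real \<Rightarrow> 'i \<Rightarrow> real" where
  "picard_iterate a 0 t i = a i"
| "picard_iterate a (Suc n) t i = a i + integral {0..t} (\<lambda>s. \<Phi> (picard_iterate a n s) i)"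

lemma picard_iterate_0: "picard_iterate a 0 t = a"
  by (rule ext) simp

lemma picard_iterate_continuous:
  "i \<in> I \<Longrightarrow> continuous_on {0..b} (\<lambda>t. picard_iterate a n t i)"
proof (induction n arbitrary: i)
  case (Suc n)
  have "continuous_on {0..b} (\<lambda>s. \<Phi> (picard_iterate a n s) i)"
    by (intro lipschitz_field_continuous Suc)
  then show ?case
    by (auto intro!: continuous_intros indefinite_integral_continuous_1 integrable_continuous_real)
qed simp

lemma picard_field_continuous:
  "i \<in> I \<Longrightarrow> continuous_on {0..b} (\<lambda>s. \<Phi> (picard_iterate a n s) i)"
  by (intro lipschitz_field_continuous picard_iterate_continuous)

text \<open>In the norm weighted by \<open>exp (- \<Lambda> * t)\<close> with \<open>\<Lambda>\<close> about twice the Lipschitz constant of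
  the whole system, one Picard step halves distances, since the integral of \<open>\<Lambda> * exp (\<Lambda> * s)\<close>
  over \<open>{0..t}\<close> is at most \<open>exp (\<Lambda> * t)\<close>. Hence the iterates converge on the whole half-line.
  The summand 1 in \<open>\<Lambda>\<close> keeps it positive for empty \<open>I\<close>.\<close>

lemma picard_iterate_step:
  fixes a :: "'i \<Rightarrow> real"
  defines "\<Lambda> \<equiv> 2 * L * (card I + 1)"
  assumes B: "\<And>i. i \<in> I \<Longrightarrow> \<bar>\<Phi> a i\<bar> \<le> B * \<Lambda>" "0 \<le> B"
  shows "i \<in> I \<Longrightarrow> 0 \<le> t \<Longrightarrow>
    \<bar>picard_iterate a (Suc n) t i - picard_iterate a n t i\<bar> \<le> B * (1 / 2) ^ n * exp (\<Lambda> * t)"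
proof (induction n arbitrary: i t)
  case 0
  have "\<Lambda> > 0"
    using L_pos by (simp add: \<Lambda>_def)
  have "\<bar>t * \<Phi> a i\<bar> \<le> t * (B * \<Lambda>)"
    using B(1) [OF 0(1)] 0(2) by (auto simp: abs_mult intro!: mult_left_mono)
  also have "\<dots> = B * (\<Lambda> * t)"
    by simp
  also have "\<dots> \<le> B * exp (\<Lambda> * t)"
    using B(2) order_trans [OF _ exp_ge_add_one_self [of "\<Lambda> * t"], of "\<Lambda> * t"]
    by (intro mult_left_mono) auto
  finally show ?case
    using 0 picard_iterate_0 [of a] by simp
next
  case (Suc n)
  have \<Lambda>: "\<Lambda> > 0"
    using L_pos by (simp add: \<Lambda>_def)
  let ?x = "picard_iterate a"
  let ?K = "B * (1 / 2) ^ Suc n"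
  have exp_int: "((\<lambda>s. ?K * (\<Lambda> * exp (\<Lambda> * s))) has_integral
      ?K * exp (\<Lambda> * t) - ?K * exp (\<Lambda> * 0)) {0..t}"
    by (rule fundamental_theorem_of_calculus [OF Suc.prems(2)])
      (auto simp: has_real_derivative_iff_has_vector_derivative [symmetric]
        intro!: derivative_eq_intros)
  have "?x (Suc (Suc n)) t i - ?x (Suc n) t i
      = integral {0..t} (\<lambda>s. \<Phi> (?x (Suc n) s) i) - integral {0..t} (\<lambda>s. \<Phi> (?x n s) i)"
    by (simp only: picard_iterate.simps(2) [of a _ t i] add_diff_cancel_left)
  also have "\<dots> = integral {0..t} (\<lambda>s. \<Phi> (?x (Suc n) s) i - \<Phi> (?x n s) i)"
    by (intro integral_diff [symmetric] integrable_continuous_real picard_field_continuous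
        Suc.prems)
  finally have "\<bar>?x (Suc (Suc n)) t i - ?x (Suc n) t i\<bar>
      = norm (integral {0..t} (\<lambda>s. \<Phi> (?x (Suc n) s) i - \<Phi> (?x n s) i))"
    by (simp only: real_norm_def)
  also have "\<dots> \<le> integral {0..t} (\<lambda>s. ?K * (\<Lambda> * exp (\<Lambda> * s)))"
  proof (rule integral_norm_bound_integral)
    show "(\<lambda>s. \<Phi> (?x (Suc n) s) i - \<Phi> (?x n s) i) integrable_on {0..t}"
      by (intro integrable_diff integrable_continuous_real picard_field_continuous Suc.prems)
    show "(\<lambda>s. ?K * (\<Lambda> * exp (\<Lambda> * s))) integrable_on {0..t}"
      using exp_int by blast
    fix s assume s: "s \<in> {0..t}"
    have "\<bar>\<Phi> (?x (Suc n) s) i - \<Phi> (?x n s) i\<bar> \<le> L * (\<Sum>j\<in>I. \<bar>?x (Suc n) s j - ?x n s j\<bar>)"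
      by (rule lipschitz [OF Suc.prems(1)])
    also have "\<dots> \<le> L * (\<Sum>j\<in>I. B * (1 / 2) ^ n * exp (\<Lambda> * s))"
      using s L_pos by (intro mult_left_mono sum_mono Suc.IH) auto
    also have "\<dots> \<le> L * ((card I + 1) * (B * (1 / 2) ^ n * exp (\<Lambda> * s)))"
      using L_pos B(2) by (intro mult_left_mono) (auto intro!: mult_right_mono)
    also have "\<dots> = ?K * (\<Lambda> * exp (\<Lambda> * s))"
      by (simp add: \<Lambda>_def)
    finally show "norm (\<Phi> (?x (Suc n) s) i - \<Phi> (?x n s) i) \<le> ?K * (\<Lambda> * exp (\<Lambda> * s))"
      by simp
  qed
  also have "\<dots> = ?K * exp (\<Lambda> * t) - ?K"
    using integral_unique [OF exp_int] by simp
  also have "\<dots> \<le> ?K * exp (\<Lambda> * t)"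
    using B(2) by simp
  finally show ?case .
qed

lemma picard_iterates_converge:
  "\<exists>z. \<forall>i\<in>I. \<forall>b. uniform_limit {0..b} (\<lambda>n t. picard_iterate a n t i) (\<lambda>t. z t i) sequentially"
proof -
  let ?x = "picard_iterate a"
  define \<Lambda> where "\<Lambda> = 2 * L * (card I + 1)"
  have \<Lambda>: "\<Lambda> > 0"
    using L_pos by (simp add: \<Lambda>_def)
  define B where "B = (\<Sum>i\<in>I. \<bar>\<Phi> a i\<bar>) / \<Lambda>"
  have B0: "0 \<le> B"
    using \<Lambda> by (auto simp: B_def intro!: divide_nonneg_pos sum_nonneg)
  have B: "\<bar>\<Phi> a i\<bar> \<le> B * \<Lambda>" if "i \<in> I" for i
    using \<Lambda> member_le_sum [OF that, of "\<lambda>i. \<bar>\<Phi> a i\<bar>"] finite_I by (simp add: B_def)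
  note step = picard_iterate_step [of a B, folded \<Lambda>_def, OF B B0]
  define z where "z t i = a i + (\<Sum>n. ?x (Suc n) t i - ?x n t i)" for t i
  have "uniform_limit {0..b} (\<lambda>n t. ?x n t i) (\<lambda>t. z t i) sequentially" if i: "i \<in> I" for i b
  proof -
    have "uniform_limit {0..b} (\<lambda>n t. \<Sum>k<n. ?x (Suc k) t i - ?x k t i)
        (\<lambda>t. \<Sum>k. ?x (Suc k) t i - ?x k t i) sequentially"
    proof (rule Weierstrass_m_test)
      show "summable (\<lambda>n. B * (1 / 2) ^ n * exp (\<Lambda> * b))"
        by (intro summable_mult summable_mult2 summable_geometric) simp
      fix n t assume t: "t \<in> {0..b}"
      have "norm (?x (Suc n) t i - ?x n t i) \<le> B * (1 / 2) ^ n * exp (\<Lambda> * t)"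
        using step [OF _ i, of t n] t by simp
      also have "\<dots> \<le> B * (1 / 2) ^ n * exp (\<Lambda> * b)"
        using t \<Lambda> B0 by (intro mult_left_mono) auto
      finally show "norm (?x (Suc n) t i - ?x n t i) \<le> B * (1 / 2) ^ n * exp (\<Lambda> * b)" .
    qed
    from uniform_limit_add [OF uniform_limit_const [where c = "\<lambda>_. a i"] this]
    moreover have "a i + (\<Sum>k<n. ?x (Suc k) t i - ?x k t i) = ?x n t i" for n t
      using sum_lessThan_telescope [of "\<lambda>k. ?x k t i" n] by (simp only: picard_iterate.simps(1))
    ultimately show ?thesis
      by (simp only: z_def)
  qed
  then show ?thesis
    by blast
qed

text \<open>Locally uniform convergence of the iterates lets the integral equation pass to the limit,
  and the limit has continuous components, so the integral equation can be differentiated.\<close>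

theorem picard_lindelof_global:
  "\<exists>z. (\<forall>i\<in>I. z 0 i = a i) \<and>
     (\<forall>b. \<forall>t\<in>{0..b}. \<forall>i\<in>I. ((\<lambda>s. z s i) has_real_derivative \<Phi> (z t) i) (at t within {0..b}))"
proof -
  let ?x = "picard_iterate a"
  obtain z where z: "\<And>i b. i \<in> I \<Longrightarrow> uniform_limit {0..b} (\<lambda>n t. ?x n t i) (\<lambda>t. z t i) sequentially"
    using picard_iterates_converge by blast
  have cont: "continuous_on {0..b} (\<lambda>t. z t i)" if "i \<in> I" for i b
    by (rule uniform_limit_theorem [OF _ z [OF that]])
      (auto intro!: always_eventually picard_iterate_continuous that)
  have field: "uniform_limit {0..b} (\<lambda>n t. \<Phi> (?x n t) i) (\<lambda>t. \<Phi> (z t) i) sequentially"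
    if i: "i \<in> I" for i b
  proof (rule uniform_limitI)
    fix e :: real assume "0 < e"
    define e' where "e' = e / (L * (card I + 1))"
    have e': "0 < e'"
      using \<open>0 < e\<close> L_pos by (simp add: e'_def)
    have "\<forall>\<^sub>F n in sequentially. \<forall>j\<in>I. \<forall>t\<in>{0..b}. dist (?x n t j) (z t j) < e'"
      using finite_I e' by (intro eventually_ball_finite) (auto intro: uniform_limitD [OF z])
    then show "\<forall>\<^sub>F n in sequentially. \<forall>t\<in>{0..b}. dist (\<Phi> (?x n t) i) (\<Phi> (z t) i) < e"
    proof (rule eventually_mono, intro ballI)
      fix n t
      assume n: "\<forall>j\<in>I. \<forall>t\<in>{0..b}. dist (?x n t j) (z t j) < e'" and t: "t \<in> {0..b}"
      have "dist (\<Phi> (?x n t) i) (\<Phi> (z t) i) \<le> L * (\<Sum>j\<in>I. \<bar>?x n t j - z t j\<bar>)"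
        by (simp add: dist_real_def lipschitz i)
      also have "\<dots> \<le> L * (\<Sum>j\<in>I. e')"
        using n t L_pos by (intro mult_left_mono sum_mono) (auto simp: dist_real_def less_imp_le)
      also have "\<dots> < L * ((card I + 1) * e')"
        using L_pos e' by simp
      also have "\<dots> = e"
        using L_pos by (simp add: e'_def)
      finally show "dist (\<Phi> (?x n t) i) (\<Phi> (z t) i) < e" .
    qed
  qed
  have eq: "z t i = a i + integral {0..t} (\<lambda>s. \<Phi> (z s) i)" if i: "i \<in> I" and t: "0 \<le> t" for t i
  proof -
    obtain J K where J: "\<And>n. ((\<lambda>s. \<Phi> (?x n s) i) has_integral J n) {0..t}"
      and K: "((\<lambda>s. \<Phi> (z s) i) has_integral K) {0..t}" and JK: "J \<longlonglongrightarrow> K"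
      by (rule uniform_limit_integral [OF field [OF i] picard_field_continuous [OF i]]) auto
    have "(\<lambda>n. ?x (Suc n) t i) \<longlonglongrightarrow> a i + K"
      using tendsto_add [OF tendsto_const JK, of "a i"] by (simp add: integral_unique [OF J])
    moreover have "(\<lambda>n. ?x (Suc n) t i) \<longlonglongrightarrow> z t i"
      using tendsto_uniform_limitI [OF z [OF i], of t t] t by (intro LIMSEQ_Suc) auto
    ultimately have "z t i = a i + K"
      using LIMSEQ_unique by blast
    then show ?thesis
      using K by (simp add: integral_unique)
  qed
  have "((\<lambda>s. z s i) has_real_derivative \<Phi> (z t) i) (at t within {0..b})"
    if t: "t \<in> {0..b}" and i: "i \<in> I" for t b i
  proof (rule has_field_derivative_transform_within [of _ _ _ _ 1])
    show "((\<lambda>t. a i + integral {0..t} (\<lambda>s. \<Phi> (z s) i)) has_real_derivative \<Phi> (z t) i)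
        (at t within {0..b})"
      using DERIV_add [OF DERIV_const [of "a i"] integral_has_real_derivative
          [OF lipschitz_field_continuous [OF i cont] t]] by simp
  qed (use t eq [OF i] in auto)
  moreover have "z 0 i = a i" if "i \<in> I" for i
    using eq [OF that, of 0] by simp
  ultimately show ?thesis
    by (intro exI [of _ z]) blast
qed

end

section \<open>A priori bounds and uniqueness\<close>

context finite_graph
begin

text \<open>The total weight \<open>S\<close> satisfies \<open>S' = K * (S - 1)\<close> with \<open>K = (\<Sum>h\<in>E. k h * X h)\<close>, so
  Gronwall applies to \<open>(S - 1)\<^sup>2\<close>. The coefficients \<open>k\<close> are arbitrary because the lemma also serves
  a modified flow.\<close>

lemma total_weight_stays_1:
  fixes k X :: "real \<Rightarrow> 'a set \<Rightarrow> real"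
  assumes "0 \<le> b"
    and deriv: "\<And>t e. t \<in> {0..b} \<Longrightarrow> e \<in> E \<Longrightarrow>
      ((\<lambda>s. X s e) has_real_derivative - k t e * X t e + X t e * (\<Sum>h\<in>E. k t h * X t h))
        (at t within {0..b})"
    and bound: "\<And>t. t \<in> {0..b} \<Longrightarrow> (\<Sum>h\<in>E. k t h * X t h) \<le> C"
    and init: "(\<Sum>e\<in>E. X 0 e) = 1"
  shows "(\<Sum>e\<in>E. X b e) = 1"
proof -
  define K where "K t = (\<Sum>h\<in>E. k t h * X t h)" for t
  define S where "S t = (\<Sum>e\<in>E. X t e)" for t
  have S: "(S has_real_derivative K t * (S t - 1)) (at t within {0..b})" if "t \<in> {0..b}" for t
  proof -
    have "(S has_real_derivative (\<Sum>e\<in>E. - k t e * X t e + X t e * K t)) (at t within {0..b})"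
      unfolding S_def K_def by (intro DERIV_sum deriv that)
    also have "(\<Sum>e\<in>E. - k t e * X t e + X t e * K t)
        = - (\<Sum>e\<in>E. k t e * X t e) + (\<Sum>e\<in>E. X t e) * K t"
      by (simp add: sum.distrib sum_negf sum_subtractf sum_distrib_right)
    also have "\<dots> = - K t + S t * K t"
      by (simp add: K_def S_def)
    also have "\<dots> = K t * (S t - 1)"
      by (simp add: algebra_simps)
    finally show ?thesis .
  qed
  have "(S b - 1)\<^sup>2 \<le> (S 0 - 1)\<^sup>2 * exp (2 * C * b)"
  proof (rule gronwall [OF \<open>0 \<le> b\<close>])
    fix t assume t: "t \<in> {0..b}"
    show "((\<lambda>t. (S t - 1)\<^sup>2) has_real_derivative 2 * K t * (S t - 1)\<^sup>2) (at t within {0..b})"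
      using S [OF t] by (auto intro!: derivative_eq_intros simp: power2_eq_square)
    show "2 * K t * (S t - 1)\<^sup>2 \<le> 2 * C * (S t - 1)\<^sup>2"
      using bound [OF t] by (intro mult_right_mono) (auto simp: K_def)
  qed
  then show ?thesis
    using init by (simp add: S_def)
qed

text \<open>When every edge is a shortest path, \<open>edge_curvature \<gamma> V E w e * w e\<close> is the limit of the
  contraction rates, and these are at least the negative of the diameter even if \<open>w e\<close> is small.\<close>

lemma weighted_curvature_bounds:
  fixes c :: real
  assumes e: "e \<in> E" and w_pos: "\<And>e. e \<in> E \<Longrightarrow> 0 < w e"
    and \<gamma>_pos: "\<And>e. e \<in> E \<Longrightarrow> 0 < \<gamma> (w e)"
    and shortest: "\<And>u v. {u, v} \<in> E \<Longrightarrow> w {u, v} = graph_dist V E w u v"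
    and total: "(\<Sum>e\<in>E. w e) \<le> c"
  shows "edge_curvature \<gamma> V E w e \<le> 2"
    and "- (card V * c) \<le> edge_curvature \<gamma> V E w e * w e"
    and "edge_curvature \<gamma> V E w e * w e \<le> 2 * c"
proof -
  obtain x y where xy: "e = {x, y}"
    using edge_cases [OF e] by blast
  with e have "{x, y} \<in> E" by simp
  have w_le: "w h \<le> c" if "h \<in> E" for h
    using member_le_sum [OF that, of w] w_pos finite_E total by (auto simp: less_imp_le)
  have c: "0 \<le> c"
    using w_le [OF e] w_pos [OF e] by linarith
  show \<kappa>: "edge_curvature \<gamma> V E w e \<le> 2"
    unfolding xy edge_curvature_doubleton
    by (rule curvature_le_2) (use w_pos \<gamma>_pos \<open>{x, y} \<in> E\<close> in auto)
  have "- (card V * c) \<le> graph_dist V E w x y * curvature \<gamma> V E w x y"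
    by (rule curvature_lower) (use w_pos \<gamma>_pos \<open>{x, y} \<in> E\<close> graph_dist_upper c w_le in auto)
  then show "- (card V * c) \<le> edge_curvature \<gamma> V E w e * w e"
    using shortest [OF \<open>{x, y} \<in> E\<close>] by (simp add: xy edge_curvature_doubleton mult.commute)
  have "edge_curvature \<gamma> V E w e * w e \<le> 2 * w e"
    using \<kappa> w_pos [OF e] by (intro mult_right_mono) auto
  also have "\<dots> \<le> 2 * c"
    using w_le [OF e] by simp
  finally show "edge_curvature \<gamma> V E w e * w e \<le> 2 * c" .
qed

lemma ricci_field_in_solution:
  "ricci_flow_solution \<gamma> V E X0 T X \<longleftrightarrow>
     (\<forall>e\<in>E. X 0 e = X0 e) \<and> (\<forall>t\<in>time_interval T. \<forall>e\<in>E. 0 < X t e) \<and>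
     (\<forall>t\<in>time_interval T. \<forall>e\<in>E.
        ((\<lambda>s. X s e) has_real_derivative ricci_field \<gamma> (X t) e) (at t within time_interval T))"
  by (simp add: ricci_flow_solution_def ricci_field_def)

end

lemma time_interval_ereal: "time_interval (ereal b) = {0..<b}"
  by (auto simp: time_interval_def)

lemma time_interval_infinity: "time_interval \<infinity> = {0..}"
  by (auto simp: time_interval_def)

lemma time_interval_Icc: "t \<in> time_interval T \<Longrightarrow> {0..t} \<subseteq> time_interval T"
  by (auto simp: time_interval_def) (metis ereal_less_eq(3) le_less_trans)

locale normalized_ricci_flow = finite_graph V E
  for V :: "'a set" and E :: "'a set set" +
  fixes \<gamma> :: "real \<Rightarrow> real" and X0 :: "'a set \<Rightarrow> real"
  assumes \<gamma>_pos: "\<And>s. 0 < s \<Longrightarrow> 0 < \<gamma> s"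
    and \<gamma>_lipschitz: "\<And>\<delta>. 0 < \<delta> \<Longrightarrow> \<exists>L. L-lipschitz_on {\<delta>..1} \<gamma>"
    and E_nonempty: "E \<noteq> {}"
    and X0_pos: "\<And>e. e \<in> E \<Longrightarrow> 0 < X0 e"
    and X0_total: "(\<Sum>e\<in>E. X0 e) = 1"
    and shortest: "\<And>T X t u v. 0 < T \<Longrightarrow> ricci_flow_solution \<gamma> V E X0 T X \<Longrightarrow> t \<in> time_interval T \<Longrightarrow>
      {u, v} \<in> E \<Longrightarrow> X t {u, v} = graph_dist V E (X t) u v"
begin

text \<open>The curvature is at most 2, and if the total weight is 1 and all edges are shortest
  paths, each of the \<open>card E\<close> summands \<open>edge_curvature \<gamma> V E w h * w h\<close> is at least
  \<open>- card V\<close>. So a weight decays at most at this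
  exponential rate.\<close>

definition decay_rate :: real where
  "decay_rate = 2 + card E * card V"

definition floor_weight :: "real \<Rightarrow> real" where
  "floor_weight t = Min (X0 ` E) * exp (- decay_rate * t)"

lemma floor_weight_pos: "0 < floor_weight t"
  using finite_E E_nonempty X0_pos by (simp add: floor_weight_def)

lemma floor_weight_le:
  assumes "e \<in> E"
  shows "floor_weight t \<le> X0 e * exp (- decay_rate * t)"
  using finite_E assms by (simp add: floor_weight_def)

lemma floor_weight_antimono: "s \<le> t \<Longrightarrow> floor_weight t \<le> floor_weight s"
  unfolding floor_weight_def
proof (rule mult_left_mono)
  assume "s \<le> t"
  then have "decay_rate * s \<le> decay_rate * t"
    by (rule mult_left_mono) (simp add: decay_rate_def)
  then show "exp (- decay_rate * t) \<le> exp (- decay_rate * s)"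
    by simp
  show "0 \<le> Min (X0 ` E)"
    using finite_E E_nonempty X0_pos by (simp add: less_imp_le)
qed

lemma X0_le_1:
  assumes "e \<in> E"
  shows "X0 e \<le> 1"
  using member_le_sum [OF assms, of X0] finite_E X0_pos X0_total by (auto simp: less_imp_le)

lemma floor_weight_le_1:
  assumes "0 \<le> t"
  shows "floor_weight t \<le> 1"
proof -
  obtain e where e: "e \<in> E"
    using E_nonempty by blast
  have "floor_weight t \<le> floor_weight 0"
    by (rule floor_weight_antimono [OF assms])
  also have "\<dots> \<le> 1"
    using floor_weight_le [OF e, of 0] X0_le_1 [OF e] by simp
  finally show ?thesis .
qed

context
  fixes X :: "real \<Rightarrow> 'a set \<Rightarrow> real" and T :: ereal
  assumes solution: "ricci_flow_solution \<gamma> V E X0 T X" and T_pos: "0 < T"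
begin

lemma solution_pos: "t \<in> time_interval T \<Longrightarrow> e \<in> E \<Longrightarrow> 0 < X t e"
  using solution by (simp add: ricci_flow_solution_def)

lemma solution_deriv:
  assumes "b \<in> time_interval T" "t \<in> {0..b}" "e \<in> E"
  shows "((\<lambda>s. X s e) has_real_derivative ricci_field \<gamma> (X t) e) (at t within {0..b})"
  by (rule DERIV_subset [OF _ time_interval_Icc [OF assms(1)]])
    (use solution assms time_interval_Icc [OF assms(1)] in \<open>auto simp: ricci_field_in_solution\<close>)

lemma solution_curvature_bounds:
  fixes c :: real
  assumes t: "t \<in> time_interval T" and e: "e \<in> E" and total: "(\<Sum>e\<in>E. X t e) \<le> c"
  shows "edge_curvature \<gamma> V E (X t) e \<le> 2"
    and "- (card V * c) \<le> edge_curvature \<gamma> V E (X t) e * X t e"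
    and "edge_curvature \<gamma> V E (X t) e * X t e \<le> 2 * c"
  using weighted_curvature_bounds [of e "X t" \<gamma> c, OF e solution_pos [OF t] \<gamma>_pos
      shortest [OF T_pos solution t] total] solution_pos [OF t] by auto

text \<open>The total weight is bounded on \<open>{0..b}\<close> by continuity; this bounds the coefficient in its
  differential equation, and then it is constant.\<close>

lemma solution_total:
  assumes b: "b \<in> time_interval T"
  shows "(\<Sum>e\<in>E. X b e) = 1"
proof -
  have "0 \<le> b"
    using b by (simp add: time_interval_def)
  have "continuous_on {0..b} (\<lambda>t. \<Sum>e\<in>E. X t e)"
    by (intro continuous_on_sum DERIV_continuous_on [OF solution_deriv [OF b]])
  then have "\<exists>t0\<in>{0..b}. \<forall>t\<in>{0..b}. (\<Sum>e\<in>E. X t e) \<le> (\<Sum>e\<in>E. X t0 e)"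
    by (intro continuous_attains_sup) (use \<open>0 \<le> b\<close> in auto)
  then obtain c where c: "\<And>t. t \<in> {0..b} \<Longrightarrow> (\<Sum>e\<in>E. X t e) \<le> c"
    by blast
  show ?thesis
  proof (rule total_weight_stays_1 [OF \<open>0 \<le> b\<close>])
    fix t assume t: "t \<in> {0..b}"
    then have tT: "t \<in> time_interval T"
      using time_interval_Icc [OF b] by blast
    show "(\<Sum>h\<in>E. edge_curvature \<gamma> V E (X t) h * X t h) \<le> card E * (2 * c)"
      using sum_bounded_above [of E _ "2 * c"] solution_curvature_bounds(3) [OF tT _ c [OF t]]
      by simp
    show "((\<lambda>s. X s e) has_real_derivative - edge_curvature \<gamma> V E (X t) e * X t e
        + X t e * (\<Sum>h\<in>E. edge_curvature \<gamma> V E (X t) h * X t h)) (at t within {0..b})"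
      if "e \<in> E" for e
      using solution_deriv [OF b t that] by (simp add: ricci_field_def)
  next
    have "(\<Sum>e\<in>E. X 0 e) = (\<Sum>e\<in>E. X0 e)"
      using solution by (intro sum.cong) (auto simp: ricci_flow_solution_def)
    then show "(\<Sum>e\<in>E. X 0 e) = 1"
      by (simp add: X0_total)
  qed
qed

lemma solution_le_1:
  assumes "t \<in> time_interval T" "e \<in> E"
  shows "X t e \<le> 1"
  using member_le_sum [OF assms(2), of "X t"] finite_E solution_pos [OF assms(1)]
    solution_total [OF assms(1)] by (auto simp: less_imp_le)

lemma solution_ge_floor:
  assumes b: "b \<in> time_interval T" and e: "e \<in> E"
  shows "floor_weight b \<le> X b e"
proof -
  have "0 \<le> b"
    using b by (simp add: time_interval_def)
  have "- X b e \<le> - X 0 e * exp (- decay_rate * b)"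
  proof (rule gronwall [OF \<open>0 \<le> b\<close>])
    fix t assume t: "t \<in> {0..b}"
    then have tT: "t \<in> time_interval T"
      using time_interval_Icc [OF b] by blast
    show "((\<lambda>t. - X t e) has_real_derivative - ricci_field \<gamma> (X t) e) (at t within {0..b})"
      by (rule DERIV_minus [OF solution_deriv [OF b t e]])
    note bounds = solution_curvature_bounds [OF tT _ eq_refl [OF solution_total [OF tT]]]
    let ?K = "\<Sum>h\<in>E. edge_curvature \<gamma> V E (X t) h * X t h"
    have "card E * (- card V) \<le> ?K"
      using sum_bounded_below [of E "- real (card V)" "\<lambda>h. edge_curvature \<gamma> V E (X t) h * X t h"]
        bounds(2) by simp
    with bounds(1) [OF e] have "- decay_rate \<le> - edge_curvature \<gamma> V E (X t) e + ?K"
      by (simp add: decay_rate_def)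
    then have "X t e * - decay_rate \<le> X t e * (- edge_curvature \<gamma> V E (X t) e + ?K)"
      using solution_pos [OF tT e] by (intro mult_left_mono) auto
    then show "- ricci_field \<gamma> (X t) e \<le> - decay_rate * - X t e"
      by (simp add: ricci_field_def algebra_simps)
  qed
  then show ?thesis
    using solution e floor_weight_le [OF e, of b] by (simp add: ricci_flow_solution_def)
qed

lemma solution_in_box:
  assumes "b \<in> time_interval T" "t \<in> {0..b}"
  shows "X t \<in> weight_box E (floor_weight b) 1"
  using assms(2) time_interval_Icc [OF assms(1)] solution_le_1 floor_weight_antimono [of t b]
  by (force simp: weight_box_def intro: order_trans [OF _ solution_ge_floor])

end

text \<open>Both solutions stay in one box on \<open>{0..b}\<close>, where the field is Lipschitz. The squared
  Euclidean distance is used for its differentiability.\<close>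

lemma solution_unique:
  assumes X: "ricci_flow_solution \<gamma> V E X0 T X" and Y: "ricci_flow_solution \<gamma> V E X0 T Y"
    and T: "0 < T" and b: "b \<in> time_interval T" and e: "e \<in> E"
  shows "X b e = Y b e"
proof -
  have "0 \<le> b"
    using b by (simp add: time_interval_def)
  let ?W = "weight_box E (floor_weight b) 1"
  have box: "X t \<in> ?W" "Y t \<in> ?W" if "t \<in> {0..b}" for t
    using solution_in_box [OF X T b that] solution_in_box [OF Y T b that] by auto
  obtain L where L: "L-lipschitz_on {floor_weight b..1} \<gamma>"
    using \<gamma>_lipschitz floor_weight_pos by blast
  have "lipschitz_bounded_on E ?W (\<lambda>w. ricci_field \<gamma> w h)" if "h \<in> E" for h
    using ricci_field_lipschitz [OF floor_weight_pos floor_weight_le_1 [OF \<open>0 \<le> b\<close>] _ L that]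
      \<gamma>_pos floor_weight_pos [of b] by (auto intro: less_le_trans)
  then have "\<exists>K. 0 \<le> K \<and> (\<forall>w\<in>?W. \<forall>w'\<in>?W.
      \<bar>ricci_field \<gamma> w h - ricci_field \<gamma> w' h\<bar> \<le> K * weight_gap E w w')" if "h \<in> E" for h
    using that unfolding lipschitz_bounded_on_def by blast
  then obtain K where K: "\<And>h. h \<in> E \<Longrightarrow> 0 \<le> K h"
    "\<And>h w w'. h \<in> E \<Longrightarrow> w \<in> ?W \<Longrightarrow> w' \<in> ?W \<Longrightarrow>
      \<bar>ricci_field \<gamma> w h - ricci_field \<gamma> w' h\<bar> \<le> K h * weight_gap E w w'"
    by metis
  define D where "D t = (\<Sum>h\<in>E. (X t h - Y t h)\<^sup>2)" for t
  have "D b \<le> D 0 * exp (2 * sum K E * card E * b)"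
  proof (rule gronwall [OF \<open>0 \<le> b\<close>])
    fix t assume t: "t \<in> {0..b}"
    let ?F = "\<lambda>h. ricci_field \<gamma> (X t) h - ricci_field \<gamma> (Y t) h"
    show "(D has_real_derivative (\<Sum>h\<in>E. 2 * (X t h - Y t h) * ?F h)) (at t within {0..b})"
      unfolding D_def
    proof (rule DERIV_sum)
      fix h assume h: "h \<in> E"
      from DERIV_power [OF DERIV_diff [OF solution_deriv [OF X T b t h] solution_deriv [OF Y T b t h]], of 2]
      show "((\<lambda>t. (X t h - Y t h)\<^sup>2) has_real_derivative 2 * (X t h - Y t h) * ?F h)
          (at t within {0..b})"
        by (simp add: mult_ac del: right_diff_distrib_numeral)
    qed
    let ?g = "weight_gap E (X t) (Y t)"
    have "(\<Sum>h\<in>E. 2 * (X t h - Y t h) * ?F h) \<le> (\<Sum>h\<in>E. 2 * (?g * (K h * ?g)))"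
    proof (rule sum_mono)
      fix h assume h: "h \<in> E"
      have "(X t h - Y t h) * ?F h \<le> \<bar>X t h - Y t h\<bar> * \<bar>?F h\<bar>"
        by (simp flip: abs_mult)
      also have "\<dots> \<le> ?g * (K h * ?g)"
        by (intro mult_mono weight_le_gap K box t h weight_gap_nonneg) simp
      finally show "2 * (X t h - Y t h) * ?F h \<le> 2 * (?g * (K h * ?g))"
        by (simp add: mult.assoc del: right_diff_distrib_numeral)
    qed
    also have "\<dots> = 2 * sum K E * ?g\<^sup>2"
      by (simp add: power2_eq_square sum_distrib_left sum_distrib_right mult_ac)
    also have "\<dots> \<le> 2 * sum K E * (D t * card E)"
    proof (rule mult_left_mono)
      show "?g\<^sup>2 \<le> D t * card E"
        using sum_squared_le_sum_of_squares [of "\<lambda>h. \<bar>X t h - Y t h\<bar>" E]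
        by (simp add: weight_gap_def D_def)
      show "0 \<le> 2 * sum K E"
        using K(1) by (simp add: sum_nonneg)
    qed
    finally show "(\<Sum>h\<in>E. 2 * (X t h - Y t h) * ?F h) \<le> 2 * sum K E * card E * D t"
      by (simp add: mult_ac)
  qed
  also have "D 0 = 0"
    using X Y by (simp add: D_def ricci_flow_solution_def)
  finally have "D b = 0"
    by (simp add: D_def sum_nonneg order_antisym)
  then show ?thesis
    using e finite_E by (simp add: D_def sum_nonneg_eq_0_iff)
qed

end

section \<open>Existence for all times\<close>

text \<open>Truncation extends the Lipschitz bound beyond 1, so that the field is defined and
  Lipschitz in a full neighbourhood of weights equal to 1.\<close>

lemma lipschitz_on_truncated:
  fixes \<gamma> :: "real \<Rightarrow> real"
  assumes "L-lipschitz_on {\<delta>..1} \<gamma>" "\<delta> \<le> 1"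
  shows "L-lipschitz_on {\<delta>..M} (\<lambda>s. \<gamma> (min s 1))"
proof (rule lipschitz_onI)
  show L: "0 \<le> L"
    using assms(1) by (rule lipschitz_on_nonneg)
  fix s t assume "s \<in> {\<delta>..M}" "t \<in> {\<delta>..M}"
  then have "dist (\<gamma> (min s 1)) (\<gamma> (min t 1)) \<le> L * dist (min s 1) (min t 1)"
    using assms by (intro lipschitz_onD) auto
  also have "\<dots> \<le> L * dist s t"
    using L by (intro mult_left_mono) (auto simp: dist_real_def)
  finally show "dist (\<gamma> (min s 1)) (\<gamma> (min t 1)) \<le> L * dist s t" .
qed

text \<open>Otherwise the times spent outside the open box form a nonempty compact set; at its least
  element the hypothesis is violated.\<close>

lemma first_exit:
  fixes z :: "real \<Rightarrow> 'i \<Rightarrow> real"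
  assumes "finite I" and cont: "\<And>i. i \<in> I \<Longrightarrow> continuous_on {0..b} (\<lambda>t. z t i)"
    and inward: "\<And>\<tau>. \<tau> \<in> {0..b} \<Longrightarrow> (\<And>t i. t \<in> {0..<\<tau>} \<Longrightarrow> i \<in> I \<Longrightarrow> l < z t i \<and> z t i < u) \<Longrightarrow>
      (\<forall>i\<in>I. l < z \<tau> i \<and> z \<tau> i < u)"
    and "t \<in> {0..b}" "i \<in> I"
  shows "l < z t i \<and> z t i < u"
proof (rule ccontr)
  assume out: "\<not> (l < z t i \<and> z t i < u)"
  define B where "B = (\<Union>i\<in>I. {0..b} \<inter> (\<lambda>t. z t i) -` ({..l} \<union> {u..}))"
  have "closed B"
    unfolding B_def using \<open>finite I\<close> cont
    by (intro closed_UN ballI continuous_closed_preimage closed_Un closed_atLeast closed_atMost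
        closed_atLeastAtMost) auto
  moreover have "B \<subseteq> {0..b}"
    by (auto simp: B_def)
  ultimately have "compact B"
    using compact_Icc compact_Int_closed [of "{0..b}" B] by (simp add: Int_absorb1)
  moreover have "t \<in> B"
    using assms(4,5) out by (auto simp: B_def not_less)
  ultimately obtain \<tau> where \<tau>: "\<tau> \<in> B" "\<And>t. t \<in> B \<Longrightarrow> \<tau> \<le> t"
    using compact_attains_inf [of B] by blast
  have "\<forall>i\<in>I. l < z \<tau> i \<and> z \<tau> i < u"
  proof (rule inward)
    show "\<tau> \<in> {0..b}"
      using \<tau>(1) by (auto simp: B_def)
    fix t i assume "t \<in> {0..<\<tau>}" "i \<in> I"
    moreover from this have "t \<notin> B"
      using \<tau>(2) by fastforce
    ultimately show "l < z t i \<and> z t i < u"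
      using \<open>\<tau> \<in> {0..b}\<close> by (auto simp: B_def not_le)
  qed
  with \<tau>(1) show False
    by (auto simp: B_def)
qed

context normalized_ricci_flow
begin

text \<open>The field with \<open>\<gamma>\<close> replaced by \<open>\<lambda>s. \<gamma> (min s 1)\<close> and the weights clipped to the box
  \<open>[\<delta>, 2]\<close> is globally Lipschitz. As long as its solution stays in the box, the total weight is 1,
  hence all weights are at most 1, both modifications are invisible, and the a priori bound
  \<open>floor_weight b > \<delta>\<close> applies. So the solution never leaves the box before time \<open>b\<close>.\<close>

lemma solution_upto:
  assumes "0 < b"
  shows "\<exists>X. ricci_flow_solution \<gamma> V E X0 (ereal b) X"
proof -
  define \<delta> where "\<delta> = floor_weight b / 2"
  have \<delta>: "0 < \<delta>" "\<delta> \<le> 1" "\<delta> < floor_weight b"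
    using floor_weight_pos [of b] floor_weight_le_1 [of b] \<open>0 < b\<close> by (auto simp: \<delta>_def)
  let ?\<gamma> = "\<lambda>s. \<gamma> (min s 1)"
  let ?W = "weight_box E \<delta> 2"
  define clip where "clip w e = max \<delta> (min 2 (w e))" for w :: "'a set \<Rightarrow> real" and e
  have clip_box: "clip w \<in> ?W" for w
    using \<delta> by (auto simp: weight_box_def clip_def)
  have clip_id: "clip w e = w e" if "w \<in> ?W" "e \<in> E" for w e
    using that by (auto simp: weight_box_def clip_def)
  have clip_gap: "weight_gap E (clip w) (clip w') \<le> weight_gap E w w'" for w w'
    unfolding weight_gap_def by (intro sum_mono) (auto simp: clip_def)
  obtain L where L: "L-lipschitz_on {\<delta>..2} ?\<gamma>"
    using \<gamma>_lipschitz [OF \<delta>(1)] lipschitz_on_truncated \<delta>(2) by blast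
  have \<gamma>_pos': "0 < ?\<gamma> s" if "\<delta> \<le> s" for s
    using that \<delta>(1) by (intro \<gamma>_pos) simp
  have lip: "lipschitz_bounded_on E ?W (\<lambda>w. ricci_field ?\<gamma> w h)"
    "lipschitz_bounded_on E ?W (\<lambda>w. edge_curvature ?\<gamma> V E w h * w h)" if "h \<in> E" for h
    using \<delta> \<gamma>_pos' L that
    by (intro ricci_field_lipschitz [where \<gamma> = ?\<gamma> and L = L] lipschitz_bounded_on_mult
        edge_curvature_lipschitz [where \<gamma> = ?\<gamma> and L = L] lipschitz_bounded_on_weight; simp)+
  have "\<exists>K. 0 \<le> K \<and> (\<forall>w\<in>?W. \<forall>w'\<in>?W.
      \<bar>ricci_field ?\<gamma> w h - ricci_field ?\<gamma> w' h\<bar> \<le> K * weight_gap E w w')" if "h \<in> E" for h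
    using lip(1) [OF that] unfolding lipschitz_bounded_on_def by blast
  then obtain K where K: "\<And>h. h \<in> E \<Longrightarrow> 0 \<le> K h"
    "\<And>h w w'. h \<in> E \<Longrightarrow> w \<in> ?W \<Longrightarrow> w' \<in> ?W \<Longrightarrow>
      \<bar>ricci_field ?\<gamma> w h - ricci_field ?\<gamma> w' h\<bar> \<le> K h * weight_gap E w w'"
    by metis
  have field_lipschitz: "\<bar>ricci_field ?\<gamma> (clip w) h - ricci_field ?\<gamma> (clip w') h\<bar>
      \<le> (sum K E + 1) * (\<Sum>e\<in>E. \<bar>w e - w' e\<bar>)" if h: "h \<in> E" for w w' h
  proof -
    have "K h \<le> sum K E + 1"
      using member_le_sum [OF h, of K] K(1) finite_E by auto
    then have "K h * weight_gap E (clip w) (clip w') \<le> (sum K E + 1) * weight_gap E w w'"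
      using K(1) by (intro mult_mono clip_gap weight_gap_nonneg) (auto intro!: add_nonneg_nonneg sum_nonneg)
    with K(2) [OF h clip_box clip_box, of w w'] show ?thesis
      by (simp add: weight_gap_def)
  qed
  have K_pos: "0 < sum K E + 1"
    using K(1) sum_nonneg [of E K] by fastforce
  have "\<exists>z. (\<forall>e\<in>E. z 0 e = X0 e) \<and> (\<forall>b. \<forall>t\<in>{0..b}. \<forall>e\<in>E.
      ((\<lambda>s. z s e) has_real_derivative ricci_field ?\<gamma> (clip (z t)) e) (at t within {0..b}))"
    by (rule picard_lindelof_global [where \<Phi> = "\<lambda>w. ricci_field ?\<gamma> (clip w)", OF finite_E _ K_pos])
      (rule field_lipschitz)
  then obtain z where z0: "\<forall>e\<in>E. z 0 e = X0 e"
    and z_deriv: "\<forall>b. \<forall>t\<in>{0..b}. \<forall>e\<in>E.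
      ((\<lambda>s. z s e) has_real_derivative ricci_field ?\<gamma> (clip (z t)) e) (at t within {0..b})"
    by (elim exE conjE)
  have z: "((\<lambda>s. z s e) has_real_derivative ricci_field ?\<gamma> (clip (z t)) e)
      (at t within {0..b})" if "t \<in> {0..b}" "e \<in> E" for b t e
    by (rule z_deriv [THEN spec, THEN bspec, THEN bspec, OF that])
  have cont: "continuous_on {0..b} (\<lambda>t. z t e)" if "e \<in> E" for e b
    by (rule DERIV_continuous_on) (rule z [OF _ that])
  have "lipschitz_bounded_on E ?W (\<lambda>w. \<Sum>h\<in>E. edge_curvature ?\<gamma> V E w h * w h)"
    by (intro lipschitz_bounded_on_sum lip(2))
  then obtain C where "\<forall>w\<in>?W. \<bar>\<Sum>h\<in>E. edge_curvature ?\<gamma> V E w h * w h\<bar> \<le> C"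
    unfolding lipschitz_bounded_on_def by blast
  then have C: "(\<Sum>h\<in>E. edge_curvature ?\<gamma> V E w h * w h) \<le> C" if "w \<in> ?W" for w
    using that abs_le_D1 by blast
  have flow: "ricci_flow_solution \<gamma> V E X0 (ereal \<tau>) z"
    if box: "\<And>t. t \<in> {0..<\<tau>} \<Longrightarrow> z t \<in> ?W" for \<tau>
  proof -
    have z': "((\<lambda>s. z s e) has_real_derivative ricci_field ?\<gamma> (z t) e) (at t within {0..a})"
      if "a < \<tau>" "t \<in> {0..a}" "e \<in> E" for a t e
    proof -
      have "ricci_field ?\<gamma> (clip (z t)) e = ricci_field ?\<gamma> (z t) e"
        by (rule ricci_field_cong) (use that clip_id [OF box] in auto)
      with z [OF that(2,3)] show ?thesis
        by simp
    qed
    have total: "(\<Sum>e\<in>E. z t e) = 1" if t: "t \<in> {0..<\<tau>}" for t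
    proof (rule total_weight_stays_1 [where k = "\<lambda>t. edge_curvature ?\<gamma> V E (z t)"])
      show "0 \<le> t"
        using t by simp
      show "(\<Sum>h\<in>E. edge_curvature ?\<gamma> V E (z s) h * z s h) \<le> C" if "s \<in> {0..t}" for s
        by (rule C [OF box]) (use that t in auto)
      show "(\<Sum>e\<in>E. z 0 e) = 1"
        by (simp add: z0 X0_total)
    qed (use z' [of t] t in \<open>simp add: ricci_field_def\<close>)
    have pos: "0 < z t e" if "t \<in> {0..<\<tau>}" "e \<in> E" for t e
      using box [OF that(1)] that(2) \<delta>(1) by (force simp: weight_box_def)
    have le_1: "z t e \<le> 1" if "t \<in> {0..<\<tau>}" "e \<in> E" for t e
      using member_le_sum [OF that(2), of "z t"] finite_E pos [OF that(1)] total [OF that(1)]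
      by (auto simp: less_imp_le)
    show ?thesis
      unfolding ricci_field_in_solution time_interval_ereal
    proof (intro conjI ballI)
      fix t e assume t: "t \<in> {0..<\<tau>}" and e: "e \<in> E"
      have "ricci_field ?\<gamma> (clip (z t)) e = ricci_field \<gamma> (z t) e"
        by (rule ricci_field_cong) (use e t clip_id [OF box] le_1 in auto)
      with z [of t \<tau> e] t e
      have "((\<lambda>s. z s e) has_real_derivative ricci_field \<gamma> (z t) e) (at t within {0..\<tau>})"
        by simp
      then show "((\<lambda>s. z s e) has_real_derivative ricci_field \<gamma> (z t) e) (at t within {0..<\<tau>})"
        by (rule DERIV_subset) auto
    qed (use z0 pos in auto)
  qed
  have inside: "\<delta> < z t e \<and> z t e < 2" if "t \<in> {0..b}" "e \<in> E" for t e
  proof (rule first_exit [OF finite_E cont _ that])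
    fix \<tau> assume \<tau>: "\<tau> \<in> {0..b}"
      and before: "\<And>t e. t \<in> {0..<\<tau>} \<Longrightarrow> e \<in> E \<Longrightarrow> \<delta> < z t e \<and> z t e < 2"
    then have box: "z t \<in> ?W" if "t \<in> {0..<\<tau>}" for t
      using that by (auto simp: weight_box_def less_imp_le)
    then have flow_\<tau>: "ricci_flow_solution \<gamma> V E X0 (ereal \<tau>) z"
      by (rule flow)
    show "\<forall>e\<in>E. \<delta> < z \<tau> e \<and> z \<tau> e < 2"
    proof
      fix e assume e: "e \<in> E"
      have "floor_weight b \<le> z \<tau> e \<and> z \<tau> e \<le> 1"
      proof (cases "\<tau> = 0")
        case True
        have "floor_weight b \<le> floor_weight 0"
          using \<open>0 < b\<close> by (intro floor_weight_antimono) simp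
        then show ?thesis
          using floor_weight_le [OF e, of 0] X0_le_1 [OF e] True z0 e by simp
      next
        case False
        with \<tau> have "0 < \<tau>" by simp
        \<comment> \<open>The bounds hold strictly before \<open>\<tau>\<close> and pass to \<open>\<tau>\<close> by continuity.\<close>
        have lim: "((\<lambda>t. z t e) \<longlongrightarrow> z \<tau> e) (at_left \<tau>)"
          by (rule continuous_on_Icc_at_leftD [OF cont [OF e] \<open>0 < \<tau>\<close>])
        have bounds: "floor_weight b \<le> z t e \<and> z t e \<le> 1" if t: "t \<in> {0<..<\<tau>}" for t
        proof -
          have "t \<in> time_interval (ereal \<tau>)" "0 < ereal \<tau>"
            using t \<open>0 < \<tau>\<close> by (simp_all add: time_interval_ereal)
          then have "floor_weight t \<le> z t e" "z t e \<le> 1"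
            using solution_ge_floor [OF flow_\<tau>] solution_le_1 [OF flow_\<tau>] e by simp_all
          with floor_weight_antimono [of t b] t \<tau> show ?thesis
            by simp
        qed
        have ev: "\<forall>\<^sub>F t in at_left \<tau>. t \<in> {0<..<\<tau>}"
          by (rule eventually_at_left_real [OF \<open>0 < \<tau>\<close>])
        show ?thesis
        proof
          show "floor_weight b \<le> z \<tau> e"
            by (rule tendsto_lowerbound [OF lim eventually_mono [OF ev]]) (use bounds in auto)
          show "z \<tau> e \<le> 1"
            by (rule tendsto_upperbound [OF lim eventually_mono [OF ev]]) (use bounds in auto)
        qed
      qed
      with \<delta> show "\<delta> < z \<tau> e \<and> z \<tau> e < 2"
        by simp
    qed
  qed
  have "ricci_flow_solution \<gamma> V E X0 (ereal b) z"
    by (rule flow) (use inside in \<open>auto simp: weight_box_def less_imp_le\<close>)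
  then show ?thesis
    by blast
qed

text \<open>The solutions on bounded intervals agree where they overlap, so at time \<open>t\<close> any of them
  whose interval extends beyond \<open>t\<close> may be used.\<close>

lemma global_solution: "\<exists>X. ricci_flow_solution \<gamma> V E X0 \<infinity> X"
proof -
  have "\<exists>Z. \<forall>b. 0 < b \<longrightarrow> ricci_flow_solution \<gamma> V E X0 (ereal b) (Z b)"
    using solution_upto by metis
  then obtain Z where Z: "\<And>b. 0 < b \<Longrightarrow> ricci_flow_solution \<gamma> V E X0 (ereal b) (Z b)"
    by blast
  define X where "X t = Z (t + 1) t" for t
  have restrict: "ricci_flow_solution \<gamma> V E X0 (ereal a) Y"
    if "ricci_flow_solution \<gamma> V E X0 (ereal b) Y" "a \<le> b" for a b Y
  proof -
    have sub: "{0..<a} \<subseteq> {0..<b}"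
      using that(2) by auto
    show ?thesis
      using that(1) sub unfolding ricci_flow_solution_def time_interval_ereal
      by (auto intro: DERIV_subset [OF _ sub])
  qed
  have agree: "X t e = Z b t e" if "0 \<le> t" "t < b" "e \<in> E" for t b e
  proof -
    let ?a = "min b (t + 1)"
    have "ricci_flow_solution \<gamma> V E X0 (ereal ?a) (Z (t + 1))"
      by (rule restrict [OF Z]) (use that in auto)
    moreover have "ricci_flow_solution \<gamma> V E X0 (ereal ?a) (Z b)"
      by (rule restrict [OF Z]) (use that in auto)
    ultimately have "Z (t + 1) t e = Z b t e"
      by (rule solution_unique) (use that in \<open>auto simp: time_interval_def\<close>)
    then show ?thesis
      by (simp add: X_def)
  qed
  have "ricci_flow_solution \<gamma> V E X0 \<infinity> X"
    unfolding ricci_field_in_solution time_interval_infinity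
  proof (intro conjI ballI)
    fix e assume "e \<in> E"
    then show "X 0 e = X0 e"
      using Z [of 1] by (simp add: X_def ricci_flow_solution_def)
  next
    fix t :: real and e assume "t \<in> {0..}" "e \<in> E"
    then show "0 < X t e"
      using Z [of "t + 1"] by (simp add: X_def ricci_flow_solution_def time_interval_ereal)
  next
    fix t :: real and e assume t: "t \<in> {0..}" and e: "e \<in> E"
    have "((\<lambda>s. Z (t + 1) s e) has_real_derivative ricci_field \<gamma> (X t) e) (at t within {0..<t + 1})"
      using Z [of "t + 1"] t e by (simp add: X_def ricci_field_in_solution time_interval_ereal)
    then have "((\<lambda>s. X s e) has_real_derivative ricci_field \<gamma> (X t) e) (at t within {0..<t + 1})"
      by (rule has_field_derivative_transform_within [of _ _ _ _ 1]) (use t e agree in auto)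
    moreover have "at t within {0..<t + 1} = at t within {0..}"
      by (rule at_within_nhd [of t "{..<t + 1}"]) auto
    ultimately show "((\<lambda>s. X s e) has_real_derivative ricci_field \<gamma> (X t) e) (at t within {0..})"
      by simp
  qed
  then show ?thesis
    by blast
qed

end

theorem theorem3:
  fixes \<gamma> :: "real \<Rightarrow> real" and V :: "'a set" and E :: "'a set set" and X0 :: "'a set \<Rightarrow> real"
  assumes "admissible \<gamma>"
    and "simple_graph V E" and "connected_graph V E" and "E \<noteq> {}"
    and "\<forall>e\<in>E. 0 < X0 e" and "(\<Sum>e\<in>E. X0 e) = 1"
    and "\<forall>T X. 0 < T \<and> ricci_flow_solution \<gamma> V E X0 T X \<longrightarrow>
           (\<forall>t\<in>time_interval T. \<forall>u v. {u, v} \<in> E \<longrightarrow> X t {u, v} = graph_dist V E (X t) u v)"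
  shows "\<exists>X. ricci_flow_solution \<gamma> V E X0 \<infinity> X \<and>
           (\<forall>Y. ricci_flow_solution \<gamma> V E X0 \<infinity> Y \<longrightarrow> (\<forall>t\<ge>0. \<forall>e\<in>E. Y t e = X t e))"
proof -
  interpret normalized_ricci_flow V E \<gamma> X0
    by unfold_locales (use assms in \<open>auto simp: admissible_def\<close>)
  obtain X where X: "ricci_flow_solution \<gamma> V E X0 \<infinity> X"
    using global_solution by blast
  have "Y t e = X t e" if "ricci_flow_solution \<gamma> V E X0 \<infinity> Y" "0 \<le> t" "e \<in> E" for Y t e
    by (rule solution_unique [OF that(1) X]) (use that in \<open>auto simp: time_interval_infinity\<close>)
  with X show ?thesis
    by blast
qed

end
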